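(* In the model described in the context, let $l\in\{1,\dots,M\}$ and $k\ge 1$ be integers such that the event $\{n(\mathcal{A}_{\mathbf{x}_o})=l,\ n(\Phi^i_{\mathbf{x}_o})=k\}$ has positive probability. Conditioned on this event, the cumulative distribution function of the random variable $X=\max_{\mathbf{y}\in\Phi^i_{\mathbf{x}_o}}P g_{\mathbf{y}}\|\mathbf{y}\|^{-\alpha_i}$ is, for $x>0$, $$F_X\bigl(x\mid n(\mathcal{A}_{\mathbf{x}_o})=l,\ n(\Phi^i_{\mathbf{x}_o})=k\bigr)=\left(1-\sum_{m=0}^{M-l}\frac{x^m}{P^m m!}\int_0^{D+\|\mathbf{x}_o\|}y^{\alpha_i m}\exp\left(-\frac{x y^{\alpha_i}}{P}\right)f^{\|\mathbf{x}_o\|}(y)\,\mathrm{d}y\right)^k.$$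
   Context: Parameters: $\lambda,D,P,\alpha_i>0$, $M\ge1$ an integer, $0<p_i\le 1$, and a point $\mathbf{x}_o\in\mathbb{R}^2$ with $\|\mathbf{x}_o\|\le D$. The radio units (RUs) of the representative cloud form a homogeneous Poisson point process $\Phi_{\mathbf{x}_o}$ of intensity $\lambda$ on the disk $\mathbf{b}(\mathbf{x}_o,D)\subset\mathbb{R}^2$ with center $\mathbf{x}_o$ and radius $D$. Each RU independently caches file $i$ with probability $p_i$; $\Phi^i_{\mathbf{x}_o}$ is the set of RUs caching file $i$ (an independent thinning of $\Phi_{\mathbf{x}_o}$). $n(\cdot)$ denotes number of elements, and the number of active RUs is $n(\mathcal{A}_{\mathbf{x}_o})=\min\{M,n(\Phi_{\mathbf{x}_o})\}$. Given $n(\mathcal{A}_{\mathbf{x}_o})=l$, the channel gains $g_{\mathbf{y}}$, $\mathbf{y}\in\Phi^i_{\mathbf{x}_o}$, are i.i.d., independent of the locations, and "chi-squared with $2(M-l+1)$ degrees of freedom" in the normalization $$\mathbb{P}(g_{\mathbf{y}}>t)=\sum_{m=0}^{M-l}\frac{t^m}{m!}e^{-t},\quad t\ge 0.$$ The function $f^{\|\mathbf{x}_o\|}$ (the density of the distance to the origin of a uniformly distributed point of $\mathbf{b}(\mathbf{x}_o,D)$) is $$f^{\|\mathbf{x}_o\|}(y)=\begin{cases}\frac{2y}{D^2}, & 0\le y<D-\|\mathbf{x}_o\|,\\ \frac{1}{\pi D^2}\frac{\partial \mathcal{B}_{\|\mathbf{x}_o\|}(y)}{\partial y}, & D-\|\mathbf{x}_o\|\le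 y<D+\|\mathbf{x}_o\|,\\ 0,& y\ge D+\|\mathbf{x}_o\|,\end{cases}$$ where $$\mathcal{B}_{x}(y)=D^2\cos^{-1}\!\left(\frac{D^2+x^2-y^2}{2xD}\right)+y^2\cos^{-1}\!\left(\frac{y^2+x^2-D^2}{2xy}\right)-\frac12\sqrt{\left[(y+x)^2-D^2\right]\left[D^2-(y-x)^2\right]}.$$ *)

theory Defs
  imports "HOL-Probability.Probability"
begin

text \<open>\<open>prob_space.indep_var\<close> requires both variables to have the same type; this is the version
  for different types: the generated \<open>\<sigma>\<close>-algebras are independent.\<close>

definition indep_pair ::
  "'w measure \<Rightarrow> 'b measure \<Rightarrow> ('w \<Rightarrow> 'b) \<Rightarrow> 'c measure \<Rightarrow> ('w \<Rightarrow> 'c) \<Rightarrow> bool" where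
  "indep_pair Q N X N' X' \<longleftrightarrow>
     X \<in> measurable Q N \<and> X' \<in> measurable Q N' \<and>
     prob_space.indep_set Q (sets (vimage_algebra (space Q) X N)) (sets (vimage_algebra (space Q) X' N'))"

text \<open>A point process on a window \<open>W\<close> is a random locally finite subset \<open>\<Phi> \<omega>\<close> of \<open>W\<close>;
  \<open>card (\<Phi> \<omega> \<inter> B)\<close> is its number of points in \<open>B\<close>.\<close>

definition homogeneous_ppp ::
  "'w measure \<Rightarrow> real \<Rightarrow> 'a::euclidean_space set \<Rightarrow> ('w \<Rightarrow> 'a set) \<Rightarrow> bool" where
  "homogeneous_ppp \<Omega> lam W \<Phi> \<longleftrightarrow>
     (\<forall>\<omega>\<in>space \<Omega>. \<Phi> \<omega> \<subseteq> W \<and> (\<forall>B. bounded B \<longrightarrow> finite (\<Phi> \<omega> \<inter> B))) \<and>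
     (\<forall>B. B \<in> sets borel \<and> bounded B \<and> B \<subseteq> W \<longrightarrow>
        (\<lambda>\<omega>. card (\<Phi> \<omega> \<inter> B)) \<in> measurable \<Omega> (count_space UNIV) \<and>
        (\<forall>n. measure \<Omega> {\<omega>\<in>space \<Omega>. card (\<Phi> \<omega> \<inter> B) = n} =
               (lam * measure lborel B) ^ n / fact n * exp (- (lam * measure lborel B)))) \<and>
     (\<forall>r. \<forall>B :: nat \<Rightarrow> 'a set.
        (\<forall>j<r. B j \<in> sets borel \<and> bounded (B j) \<and> B j \<subseteq> W) \<and> disjoint_family_on B {..<r} \<longrightarrow>
        prob_space.indep_vars \<Omega> (\<lambda>_. count_space UNIV) (\<lambda>j \<omega>. card (\<Phi> \<omega> \<inter> B j)) {..<r})"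

text \<open>Marks of the points are made into random variables by labelling the points of a (finite)
  point process measurably as \<open>Y 0 \<omega>, \<dots>, Y (n - 1) \<omega>\<close>, \<open>n = card (\<Phi> \<omega>)\<close>. The labelling
  is arbitrary; no distribution of the labelled points is prescribed. For \<open>j \<ge> n\<close> the value
  \<open>Y j \<omega>\<close> is irrelevant.\<close>

definition enumerates ::
  "'w measure \<Rightarrow> (nat \<Rightarrow> 'w \<Rightarrow> 'a::euclidean_space) \<Rightarrow> ('w \<Rightarrow> 'a set) \<Rightarrow> bool" where
  "enumerates \<Omega> Y \<Phi> \<longleftrightarrow>
     (\<forall>j. Y j \<in> borel_measurable \<Omega>) \<and>
     (\<forall>\<omega>\<in>space \<Omega>. bij_betw (\<lambda>j. Y j \<omega>) {..<card (\<Phi> \<omega>)} (\<Phi> \<omega>))"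

text \<open>\<open>uniform_measure \<Omega> E\<close> is the conditional probability measure given \<open>E\<close>.
  Conditionally on the number \<open>n\<close> of points, the \<open>n\<close> retention indicators are i.i.d. Bernoulli
  with parameter \<open>p\<close>, and independent of the vector of locations.\<close>

definition independent_thinning ::
  "'w measure \<Rightarrow> real \<Rightarrow> (nat \<Rightarrow> 'w \<Rightarrow> 'a::euclidean_space) \<Rightarrow> ('w \<Rightarrow> 'a set) \<Rightarrow> ('w \<Rightarrow> 'a set) \<Rightarrow> bool"
  where
  "independent_thinning \<Omega> p Y \<Phi> \<Psi> \<longleftrightarrow>
     (\<forall>\<omega>\<in>space \<Omega>. \<Psi> \<omega> \<subseteq> \<Phi> \<omega>) \<and>
     (\<forall>n. let E = {\<omega>\<in>space \<Omega>. card (\<Phi> \<omega>) = n}; Q = uniform_measure \<Omega> E in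
        measure \<Omega> E > 0 \<longrightarrow>
          prob_space.indep_vars Q (\<lambda>_. count_space UNIV) (\<lambda>j \<omega>. Y j \<omega> \<in> \<Psi> \<omega>) {..<n} \<and>
          (\<forall>j<n. measure Q {\<omega>\<in>space Q. Y j \<omega> \<in> \<Psi> \<omega>} = p) \<and>
          indep_pair Q
            (\<Pi>\<^sub>M j\<in>{..<n}. borel) (\<lambda>\<omega>. \<lambda>j\<in>{..<n}. Y j \<omega>)
            (\<Pi>\<^sub>M j\<in>{..<n}. count_space UNIV) (\<lambda>\<omega>. \<lambda>j\<in>{..<n}. Y j \<omega> \<in> \<Psi> \<omega>))"

text \<open>\<open>g \<omega> y\<close> is the gain of the point \<open>y\<close>. The family of gains is indexed by the random set
  \<open>\<Psi> \<omega>\<close>, so the condition is imposed given that \<open>\<Phi>\<close> has \<open>n\<close> points, \<open>S\<close> being the set of labels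
  of those in \<open>\<Psi>\<close>; the number of active points is then \<open>l = min M n\<close>.\<close>

definition iid_gains ::
  "'w measure \<Rightarrow> nat \<Rightarrow> (nat \<Rightarrow> 'w \<Rightarrow> 'a::euclidean_space) \<Rightarrow> ('w \<Rightarrow> 'a set) \<Rightarrow> ('w \<Rightarrow> 'a set)
     \<Rightarrow> ('w \<Rightarrow> 'a \<Rightarrow> real) \<Rightarrow> bool" where
  "iid_gains \<Omega> M Y \<Phi> \<Psi> g \<longleftrightarrow>
     (\<forall>n. \<forall>S\<subseteq>{..<n}.
        let l = min M n;
            E = {\<omega>\<in>space \<Omega>. card (\<Phi> \<omega>) = n \<and> {j\<in>{..<n}. Y j \<omega> \<in> \<Psi> \<omega>} = S};
            Q = uniform_measure \<Omega> E
        in measure \<Omega> E > 0 \<longrightarrow>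
          prob_space.indep_vars Q (\<lambda>_. borel) (\<lambda>j \<omega>. g \<omega> (Y j \<omega>)) S \<and>
          (\<forall>j\<in>S. \<forall>t\<ge>0. measure Q {\<omega>\<in>space Q. g \<omega> (Y j \<omega>) > t} =
                          (\<Sum>m=0..M - l. t ^ m / fact m * exp (- t))) \<and>
          indep_pair Q
            (\<Pi>\<^sub>M j\<in>{..<n}. borel) (\<lambda>\<omega>. \<lambda>j\<in>{..<n}. Y j \<omega>)
            (\<Pi>\<^sub>M j\<in>S. borel) (\<lambda>\<omega>. \<lambda>j\<in>S. g \<omega> (Y j \<omega>)))"

definition overlap_area :: "real \<Rightarrow> real \<Rightarrow> real \<Rightarrow> real" where
  "overlap_area D x y =
     D\<^sup>2 * arccos ((D\<^sup>2 + x\<^sup>2 - y\<^sup>2) / (2 * x * D))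
     + y\<^sup>2 * arccos ((y\<^sup>2 + x\<^sup>2 - D\<^sup>2) / (2 * x * y))
     - 1 / 2 * sqrt (((y + x)\<^sup>2 - D\<^sup>2) * (D\<^sup>2 - (y - x)\<^sup>2))"

text \<open>At the endpoint \<open>y = D - x\<close> the two-sided derivative need not exist; this single point does
  not affect integrals.\<close>

definition distance_density :: "real \<Rightarrow> real \<Rightarrow> real \<Rightarrow> real" where
  "distance_density D x y =
     (if 0 \<le> y \<and> y < D - x then 2 * y / D\<^sup>2
      else if D - x \<le> y \<and> y < D + x then 1 / (pi * D\<^sup>2) * deriv (overlap_area D x) y
      else 0)"

end

theory Submission
  imports Defs
begin

text \<open>
  For a bounded function \<open>u\<close>, step functions and the multinomial theorem show that
  \<open>\<Prod>y\<in>\<Phi>. u y\<close> integrates to \<open>(lam \<integral>\<^sub>W u)\<^sup>n / n! \<cdot> exp (- lam |W|)\<close> over the event \<open>card \<Phi> = n\<close>.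
  With \<open>u = 1 + t h\<close>, comparing coefficients of \<open>t\<^sup>k\<close> gives the mean of
  \<open>\<Sum>S. \<Prod>j\<in>S. h (Y j)\<close> over the \<open>k\<close>-subsets \<open>S\<close> of the labels; this sum is symmetric, so the
  arbitrary labelling does not matter. Taking \<open>h y\<close> to be the probability that the gain of a point at
  \<open>y\<close> is at most \<open>x |y|\<^sup>\<alpha> / P\<close>, thinning and gains reduce the claim to the \<open>k\<close>-th power of the mean
  of \<open>h\<close> over the disk, whatever the value of \<open>n\<close>. In polar coordinates based at the direction of
  \<open>x\<^sub>o\<close>, the circle of radius \<open>y\<close> meets the disk in an arc of angle \<open>2 arccos c\<close>,
  \<open>c = (y\<^sup>2 + |x\<^sub>o|\<^sup>2 - D\<^sup>2) / (2 |x\<^sub>o| y)\<close>, and \<open>2 y arccos c\<close> is the derivative of the overlap area.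
\<close>

section \<open>Product functionals of a Poisson point process\<close>

text \<open>The obstacle is that, given n points, the labelled points are not assumed to be
  independent and uniform; a labelling by increasing norm, say, violates this. For one fixed set S
  of labels the mean of \<open>\<Prod>j\<in>S. h (Y j \<omega>)\<close> is therefore unknown, and
  only the sum over all S of the same size can be evaluated. The thinning produces exactly such
  sums: given n, retention is independent of the locations, so the probability p^k (1 - p)^(n - k)
  of retaining precisely the labels in S is the same for all S of size k and comes out of the sum.
  Restricting to n points also makes the generating function a polynomial in t of degree at most n,
  so that comparing coefficients raises no question of convergence. That the resulting factor is
  free of n matters for l = M, where the conditioning event joins infinitely many values of
  n.\<close>

lemma binomial_exp_series:
  fixes a b :: real
  shows "(\<Sum>m\<le>n. a ^ (n - m) / fact (n - m) * (b ^ m / fact m)) = (a + b) ^ n / fact n"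
proof -
  have "(a + b) ^ n = (\<Sum>m\<le>n. of_nat (n choose m) * b ^ m * a ^ (n - m))"
    by (subst add.commute) (rule binomial_ring)
  also have "\<dots> = fact n * (\<Sum>m\<le>n. a ^ (n - m) / fact (n - m) * (b ^ m / fact m))"
    unfolding sum_distrib_left
    by (intro sum.cong refl) (simp add: binomial_fact field_simps)
  finally show ?thesis by simp
qed

text \<open>Up to the exponential factor this is the multinomial theorem. The induction on r splits
  off the last count; the convolution over its value is \<open>binomial_exp_series\<close>, which
  compares the coefficients of s^n in exp (a s) exp (b s) = exp ((a + b) s). Integrability is proved
  along with the value because the product rule for independent variables asks for it.\<close>

lemma (in prob_space) poisson_counts_expectation:
  fixes N :: "nat \<Rightarrow> 'a \<Rightarrow> nat" and c a :: "nat \<Rightarrow> real"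
  assumes indep: "indep_vars (\<lambda>_. count_space UNIV) N {..<r}"
    and dist: "\<And>i m. i < r \<Longrightarrow> prob {\<omega>\<in>space M. N i \<omega> = m} = a i ^ m / fact m * exp (- a i)"
  shows "integrable M (\<lambda>\<omega>. if (\<Sum>i<r. N i \<omega>) = n then \<Prod>i<r. c i ^ N i \<omega> else 0)" (is ?I)
    and "expectation (\<lambda>\<omega>. if (\<Sum>i<r. N i \<omega>) = n then \<Prod>i<r. c i ^ N i \<omega> else 0) =
           (\<Sum>i<r. c i * a i) ^ n / fact n * exp (- (\<Sum>i<r. a i))" (is ?E)
proof -
  have "?I \<and> ?E" using indep dist
  proof (induction r arbitrary: n)
    case 0
    have "expectation (\<lambda>\<omega>. if n = 0 then 1 else 0 :: real) = (if n = 0 then 1 else 0)"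
      by (cases "n = 0") (simp_all add: prob_space)
    then show ?case by (cases "n = 0") (auto simp: prob_space)
  next
    case (Suc r)
    have rv[measurable]: "N i \<in> measurable M (count_space UNIV)" if "i < Suc r" for i
      using Suc.prems(1) that by (auto simp: indep_vars_def)
    have indr: "indep_vars (\<lambda>_. count_space UNIV) N {..<r}"
      by (rule indep_vars_subset[OF Suc.prems(1)]) auto
    define Z where "Z k \<omega> = (if (\<Sum>i<r. N i \<omega>) = k then \<Prod>i<r. c i ^ N i \<omega> else 0)" for k \<omega>
    define V where "V m \<omega> = (if N r \<omega> = m then c r ^ m else 0)" for m \<omega>
    have IH: "integrable M (Z k)"
       "expectation (Z k) = (\<Sum>i<r. c i * a i) ^ k / fact k * exp (- (\<Sum>i<r. a i))" for k
      unfolding Z_def using Suc.IH[OF indr] Suc.prems(2) by auto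
    have setV[measurable]: "{\<omega>\<in>space M. N r \<omega> = m} \<in> sets M" for m by measurable
    have V: "V m = (\<lambda>\<omega>. c r ^ m * indicator {\<omega>. N r \<omega> = m} \<omega>)" for m
      by (auto simp: V_def fun_eq_iff)
    have intV: "integrable M (V m)" for m
      unfolding V_def by (intro integrable_const_bound[where B="\<bar>c r ^ m\<bar>"]) auto
    have EV: "expectation (V m) = (c r * a r) ^ m / fact m * exp (- a r)" for m
    proof -
      have "expectation (V m) = c r ^ m * expectation (indicator {\<omega>\<in>space M. N r \<omega> = m})"
        unfolding V by (subst integral_mult_right_zero[symmetric])
          (auto intro!: Bochner_Integration.integral_cong simp: indicator_def)
      also have "\<dots> = c r ^ m * prob {\<omega>\<in>space M. N r \<omega> = m}" by simp
      finally show ?thesis using Suc.prems(2)[of r m] by (simp add: power_mult_distrib)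
    qed
    \<comment> \<open>If the total is n, the last count has exactly one value m \<le> n; the factor
      \<open>V\<close> kills all other summands.\<close>
    have split: "(if (\<Sum>i<Suc r. N i \<omega>) = n then \<Prod>i<Suc r. c i ^ N i \<omega> else 0) =
          (\<Sum>m\<le>n. Z (n - m) \<omega> * V m \<omega>)" for \<omega>
    proof -
      have "(\<Sum>m\<le>n. Z (n - m) \<omega> * V m \<omega>) =
         (\<Sum>m\<le>n. if m = N r \<omega> then Z (n - N r \<omega>) \<omega> * c r ^ N r \<omega> else 0)"
        by (intro sum.cong) (auto simp: V_def)
      also have "\<dots> = (if N r \<omega> \<le> n then Z (n - N r \<omega>) \<omega> * c r ^ N r \<omega> else 0)"
        by (subst sum.delta) auto
      finally show ?thesis by (auto simp: Z_def)
    qed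
    have ind: "indep_var borel (Z k) borel (V m)" for k m
    proof -
      have "indep_var (PiM {..<r} (\<lambda>_. count_space UNIV)) (\<lambda>\<omega>. restrict (\<lambda>i. N i \<omega>) {..<r})
         (PiM {r} (\<lambda>_. count_space UNIV)) (\<lambda>\<omega>. restrict (\<lambda>i. N i \<omega>) {r})"
        by (rule indep_var_restrict[OF Suc.prems(1)]) auto
      then have "indep_var borel ((\<lambda>f. if (\<Sum>i<r. f i) = k then \<Prod>i<r. c i ^ f i else 0) \<circ> (\<lambda>\<omega>. restrict (\<lambda>i. N i \<omega>) {..<r}))
         borel ((\<lambda>f. if f r = m then c r ^ m else 0) \<circ> (\<lambda>\<omega>. restrict (\<lambda>i. N i \<omega>) {r}))"
        by (rule indep_var_compose) measurable
      also have "(\<lambda>f. if (\<Sum>i<r. f i) = k then \<Prod>i<r. c i ^ f i else 0) \<circ> (\<lambda>\<omega>. restrict (\<lambda>i. N i \<omega>) {..<r}) = Z k"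
        by (auto simp: Z_def fun_eq_iff)
      also have "(\<lambda>f. if f r = m then c r ^ m else 0) \<circ> (\<lambda>\<omega>. restrict (\<lambda>i. N i \<omega>) {r}) = V m"
        by (auto simp: V_def fun_eq_iff)
      finally show ?thesis .
    qed
    have "integrable M (\<lambda>\<omega>. Z k \<omega> * V m \<omega>)" for k m
      by (rule indep_var_integrable[OF ind IH(1) intV])
    moreover have "expectation (\<lambda>\<omega>. Z k \<omega> * V m \<omega>) = expectation (Z k) * expectation (V m)" for k m
      by (rule indep_var_lebesgue_integral[OF ind IH(1) intV])
    ultimately have "integrable M (\<lambda>\<omega>. \<Sum>m\<le>n. Z (n - m) \<omega> * V m \<omega>)"
      and E: "expectation (\<lambda>\<omega>. \<Sum>m\<le>n. Z (n - m) \<omega> * V m \<omega>) =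
        (\<Sum>m\<le>n. expectation (Z (n - m)) * expectation (V m))"
      by simp_all
    moreover have "(\<Sum>m\<le>n. expectation (Z (n - m)) * expectation (V m)) =
        (\<Sum>i<Suc r. c i * a i) ^ n / fact n * exp (- (\<Sum>i<Suc r. a i))"
    proof -
      have "(\<Sum>m\<le>n. expectation (Z (n - m)) * expectation (V m)) =
          (\<Sum>m\<le>n. (\<Sum>i<r. c i * a i) ^ (n - m) / fact (n - m) * ((c r * a r) ^ m / fact m)) *
            (exp (- (\<Sum>i<r. a i)) * exp (- a r))"
        unfolding IH EV sum_distrib_right by (intro sum.cong) auto
      then show ?thesis
        unfolding binomial_exp_series by (simp add: exp_diff exp_minus field_simps)
    qed
    ultimately show ?case
      unfolding split by simp
  qed
  then show ?I ?E by auto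
qed

lemma set_integrable_bounded:
  fixes f :: "'a::euclidean_space \<Rightarrow> real"
  assumes W: "W \<in> sets borel" "bounded W" and f: "f \<in> borel_measurable borel" and C: "\<And>y. \<bar>f y\<bar> \<le> C"
  shows "set_integrable lborel W f"
proof -
  have "emeasure lborel W < \<infinity>" using W emeasure_bounded_finite by blast
  then have int: "integrable lborel (\<lambda>y. C * indicator W y)" using W by auto
  have "\<bar>C\<bar> = C" using C[of 0] by simp
  then show ?thesis
    unfolding set_integrable_def
    by (intro Bochner_Integration.integrable_bound[OF int]) (use W f C in \<open>auto simp: indicator_def\<close>)
qed

text \<open>On a cell where u has the constant value \<open>c i\<close>, every point contributes the
  same factor, so the product over the points is determined by the counts of the cells. These are
  independent Poisson variables, and the sum of \<open>c i\<close> times the measure of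
  \<open>B i\<close> is the integral of u.\<close>

lemma ppp_prod_expectation_step:
  fixes \<Phi> :: "'w \<Rightarrow> 'a::euclidean_space set" and B :: "nat \<Rightarrow> 'a set" and u :: "'a \<Rightarrow> real"
  assumes "prob_space \<Omega>" and ppp: "homogeneous_ppp \<Omega> lam W \<Phi>"
    and W: "W \<in> sets borel" "bounded W"
    and B: "\<And>i. i < r \<Longrightarrow> B i \<in> sets borel" "disjoint_family_on B {..<r}" "(\<Union>i<r. B i) = W"
    and u: "\<And>i y. i < r \<Longrightarrow> y \<in> B i \<Longrightarrow> u y = c i"
  shows "(\<integral>\<omega>. (if card (\<Phi> \<omega>) = n then \<Prod>y\<in>\<Phi> \<omega>. u y else 0) \<partial>\<Omega>) =
     (lam * (LINT y:W|lborel. u y)) ^ n / fact n * exp (- (lam * measure lborel W))"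
proof -
  interpret prob_space \<Omega> by fact
  have BW: "B i \<subseteq> W" "bounded (B i)" if "i < r" for i
    using that B(3) W(2) by (auto intro: bounded_subset)
  have em: "emeasure lborel (B i) < \<infinity>" if "i < r" for i
    using emeasure_bounded_finite[OF BW(2)[OF that]] by auto
  have fin: "finite (\<Phi> \<omega>)" "\<Phi> \<omega> \<subseteq> W" if "\<omega> \<in> space \<Omega>" for \<omega>
  proof -
    show "\<Phi> \<omega> \<subseteq> W" using ppp that by (auto simp: homogeneous_ppp_def)
    moreover have "finite (\<Phi> \<omega> \<inter> W)" using ppp that W by (auto simp: homogeneous_ppp_def)
    ultimately show "finite (\<Phi> \<omega>)" by (simp add: Int_absorb2)
  qed
  define N where "N i \<omega> = card (\<Phi> \<omega> \<inter> B i)" for i \<omega>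
  have indep: "indep_vars (\<lambda>_. count_space UNIV) N {..<r}"
    unfolding N_def
    by (rule ppp[unfolded homogeneous_ppp_def, THEN conjunct2, THEN conjunct2, rule_format])
      (use B BW in auto)
  have dist: "prob {\<omega>\<in>space \<Omega>. N i \<omega> = m} =
      (lam * measure lborel (B i)) ^ m / fact m * exp (- (lam * measure lborel (B i)))" if "i < r" for i m
    unfolding N_def
    by (rule ppp[unfolded homogeneous_ppp_def, THEN conjunct2, THEN conjunct1, rule_format,
          THEN conjunct2, rule_format]) (use B BW that in auto)
  have dec: "\<Phi> \<omega> = (\<Union>i<r. \<Phi> \<omega> \<inter> B i)" if "\<omega> \<in> space \<Omega>" for \<omega>
    using fin(2)[OF that] B(3) by auto
  have disj: "\<forall>i\<in>{..<r}. \<forall>j\<in>{..<r}. i \<noteq> j \<longrightarrow> (\<Phi> \<omega> \<inter> B i) \<inter> (\<Phi> \<omega> \<inter> B j) = {}" for \<omega>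
    using B(2) by (auto simp: disjoint_family_on_def)
  have cardN: "card (\<Phi> \<omega>) = (\<Sum>i<r. N i \<omega>)" if "\<omega> \<in> space \<Omega>" for \<omega>
    by (subst dec[OF that], subst card_UN_disjoint) (use fin[OF that] disj in \<open>auto simp: N_def\<close>)
  have prodN: "(\<Prod>y\<in>\<Phi> \<omega>. u y) = (\<Prod>i<r. c i ^ N i \<omega>)" if "\<omega> \<in> space \<Omega>" for \<omega>
  proof -
    have "(\<Prod>y\<in>\<Phi> \<omega>. u y) = (\<Prod>i<r. \<Prod>y\<in>\<Phi> \<omega> \<inter> B i. u y)"
      by (subst dec[OF that], rule prod.UNION_disjoint) (use fin[OF that] disj in auto)
    also have "\<dots> = (\<Prod>i<r. \<Prod>y\<in>\<Phi> \<omega> \<inter> B i. c i)"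
      by (intro prod.cong refl) (auto simp: u)
    finally show ?thesis by (simp add: N_def)
  qed
  have intB: "integrable lborel (indicator (B i) :: 'a \<Rightarrow> real)" if "i < r" for i
    using em[OF that] B(1)[OF that] by auto
  have area: "(LINT y:W|lborel. u y) = (\<Sum>i<r. c i * measure lborel (B i))"
  proof -
    have "(LINT y:W|lborel. u y) = (LINT y|lborel. (\<Sum>i<r. c i * indicator (B i) y))"
      unfolding set_lebesgue_integral_def
    proof (intro Bochner_Integration.integral_cong refl)
      fix y
      have "(\<Sum>i<r. c i * indicator (B i) y) = u y * (\<Sum>i<r. indicator (B i) y)"
        unfolding sum_distrib_left by (intro sum.cong) (auto simp: indicator_def u)
      also have "(\<Sum>i<r. indicator (B i) y) = (indicator W y :: real)"
        unfolding B(3)[symmetric] by (rule indicator_UN_disjoint[symmetric]) (simp_all add: B(2))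
      finally show "indicator W y *\<^sub>R u y = (\<Sum>i<r. c i * indicator (B i) y)"
        by simp
    qed
    also have "\<dots> = (\<Sum>i<r. c i * measure lborel (B i))"
      by (subst Bochner_Integration.integral_sum) (auto simp: intB)
    finally show ?thesis .
  qed
  have mW: "measure lborel W = (\<Sum>i<r. measure lborel (B i))"
    unfolding B(3)[symmetric] using em B
    by (intro measure_finite_Union) (auto simp: less_top)
  have "(\<integral>\<omega>. (if card (\<Phi> \<omega>) = n then \<Prod>y\<in>\<Phi> \<omega>. u y else 0) \<partial>\<Omega>) =
     (\<integral>\<omega>. (if (\<Sum>i<r. N i \<omega>) = n then \<Prod>i<r. c i ^ N i \<omega> else 0) \<partial>\<Omega>)"
    by (intro Bochner_Integration.integral_cong refl) (simp add: cardN prodN)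
  also have "\<dots> = (\<Sum>i<r. c i * (lam * measure lborel (B i))) ^ n / fact n * exp (- (\<Sum>i<r. lam * measure lborel (B i)))"
    by (rule poisson_counts_expectation(2)[OF indep dist])
  also have "(\<Sum>i<r. c i * (lam * measure lborel (B i))) = lam * (LINT y:W|lborel. u y)"
    by (simp add: area sum_distrib_left mult_ac)
  also have "(\<Sum>i<r. lam * measure lborel (B i)) = lam * measure lborel W"
    by (simp add: mW sum_distrib_left)
  finally show ?thesis .
qed

lemma enumerates_prod:
  fixes u :: "'a::euclidean_space \<Rightarrow> real"
  assumes "enumerates \<Omega> Y \<Phi>" "\<omega> \<in> space \<Omega>"
  shows "(\<Prod>y\<in>\<Phi> \<omega>. u y) = (\<Prod>j<card (\<Phi> \<omega>). u (Y j \<omega>))"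
  using assms by (intro prod.reindex_bij_betw[symmetric]) (auto simp: enumerates_def)

lemma homogeneous_ppp_card:
  assumes ppp: "homogeneous_ppp \<Omega> lam W \<Phi>" and W: "W \<in> sets borel" "bounded W"
  shows "(\<lambda>\<omega>. card (\<Phi> \<omega>)) \<in> measurable \<Omega> (count_space UNIV)"
    and "measure \<Omega> {\<omega>\<in>space \<Omega>. card (\<Phi> \<omega>) = n} =
      (lam * measure lborel W) ^ n / fact n * exp (- (lam * measure lborel W))"
proof -
  have "\<Phi> \<omega> \<inter> W = \<Phi> \<omega>" if "\<omega> \<in> space \<Omega>" for \<omega>
    using ppp that by (auto simp: homogeneous_ppp_def)
  note eq = this
  have "(\<lambda>\<omega>. card (\<Phi> \<omega> \<inter> W)) \<in> measurable \<Omega> (count_space UNIV)"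
    "measure \<Omega> {\<omega>\<in>space \<Omega>. card (\<Phi> \<omega> \<inter> W) = n} =
      (lam * measure lborel W) ^ n / fact n * exp (- (lam * measure lborel W))"
    using ppp W by (auto simp: homogeneous_ppp_def)
  then show "(\<lambda>\<omega>. card (\<Phi> \<omega>)) \<in> measurable \<Omega> (count_space UNIV)"
    "measure \<Omega> {\<omega>\<in>space \<Omega>. card (\<Phi> \<omega>) = n} =
      (lam * measure lborel W) ^ n / fact n * exp (- (lam * measure lborel W))"
    by (simp_all add: eq cong: measurable_cong conj_cong Collect_cong)
qed

text \<open>Step functions approximate u and both sides pass to the limit by dominated convergence,
  with bound \<open>C ^ n\<close> on the probability space and C times the indicator of the bounded
  window on the other side. Writing the product over the labels makes the integrand measurable, as
  the limit theorem requires.\<close>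

lemma ppp_prod_expectation:
  fixes \<Phi> :: "'w \<Rightarrow> 'a::euclidean_space set" and u :: "'a \<Rightarrow> real"
  assumes "prob_space \<Omega>" and ppp: "homogeneous_ppp \<Omega> lam W \<Phi>" and en: "enumerates \<Omega> Y \<Phi>"
    and W: "W \<in> sets borel" "bounded W"
    and u[measurable]: "u \<in> borel_measurable borel" and C: "\<And>y. \<bar>u y\<bar> \<le> C"
  shows "(\<integral>\<omega>. (if card (\<Phi> \<omega>) = n then \<Prod>j<n. u (Y j \<omega>) else 0) \<partial>\<Omega>) =
     (lam * (LINT y:W|lborel. u y)) ^ n / fact n * exp (- (lam * measure lborel W))"
proof -
  interpret prob_space \<Omega> by fact
  have C0: "C \<ge> 0" using C[of 0] by linarith
  have Y[measurable]: "Y j \<in> borel_measurable \<Omega>" for j using en by (auto simp: enumerates_def)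
  note [measurable] = homogeneous_ppp_card(1)[OF ppp W]
  have [measurable]: "W \<in> sets borel" by fact
  have fW: "emeasure lborel W < \<infinity>" using W emeasure_bounded_finite by blast
  \<comment> \<open>step functions at distance at most \<open>1 / (k + 1)\<close> from \<open>u\<close>\<close>
  define v where "v k y = real_of_int \<lfloor>real (Suc k) * (u y + C)\<rfloor> / real (Suc k) - C" for k y
  have [measurable]: "v k \<in> borel_measurable borel" for k unfolding v_def by measurable
  have v1: "v k y \<le> u y" "u y - 1 / real (Suc k) \<le> v k y" for k y
  proof -
    have "real_of_int \<lfloor>real (Suc k) * (u y + C)\<rfloor> \<le> real (Suc k) * (u y + C)" by linarith
    then have "real_of_int \<lfloor>real (Suc k) * (u y + C)\<rfloor> / real (Suc k) \<le> u y + C"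
      by (simp add: pos_divide_le_eq mult.commute del: of_nat_Suc)
    then show "v k y \<le> u y" by (simp add: v_def)
    have "real (Suc k) * (u y + C) - 1 \<le> real_of_int \<lfloor>real (Suc k) * (u y + C)\<rfloor>" by linarith
    then have "(real (Suc k) * (u y + C) - 1) / real (Suc k) \<le> real_of_int \<lfloor>real (Suc k) * (u y + C)\<rfloor> / real (Suc k)"
      by (intro divide_right_mono) auto
    moreover have "(real (Suc k) * (u y + C) - 1) / real (Suc k) = u y + C - 1 / real (Suc k)"
      by (simp add: diff_divide_distrib del: of_nat_Suc)
    ultimately show "u y - 1 / real (Suc k) \<le> v k y" by (simp add: v_def)
  qed
  have v0: "- C \<le> v k y" for k y
    using C[of y] by (simp add: v_def)
  have vC: "\<bar>v k y\<bar> \<le> C" for k y using v0[of k y] v1(1)[of k y] C[of y] by linarith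
  have vlim: "(\<lambda>k. v k y) \<longlonglongrightarrow> u y" for y
  proof (rule tendsto_sandwich)
    show "(\<lambda>k. u y - 1 / real (Suc k)) \<longlonglongrightarrow> u y"
      using tendsto_diff[OF tendsto_const LIMSEQ_Suc[OF lim_1_over_n]] by force
    show "(\<lambda>k. u y) \<longlonglongrightarrow> u y" by simp
  qed (use v1 in auto)
  have step: "(\<integral>\<omega>. (if card (\<Phi> \<omega>) = n then \<Prod>j<n. v k (Y j \<omega>) else 0) \<partial>\<Omega>) =
     (lam * (LINT y:W|lborel. v k y)) ^ n / fact n * exp (- (lam * measure lborel W))" for k
  proof -
    \<comment> \<open>The shift by C makes every level a nonnegative integer, so levels can index
      cells; they are at most the floor of (k + 1) * 2 C, which fixes the number of cells.\<close>
    define r where "r = Suc (nat \<lfloor>real (Suc k) * (2 * C)\<rfloor>)"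
    define B where "B i = {y\<in>W. \<lfloor>real (Suc k) * (u y + C)\<rfloor> = int i}" for i
    have Bsets: "B i \<in> sets borel" for i unfolding B_def by measurable
    have cover: "(\<Union>i<r. B i) = W"
    proof (intro equalityI subsetI)
      fix y assume y: "y \<in> W"
      have nn: "0 \<le> \<lfloor>real (Suc k) * (u y + C)\<rfloor>" using C[of y] by (simp del: of_nat_Suc)
      have "\<lfloor>real (Suc k) * (u y + C)\<rfloor> \<le> \<lfloor>real (Suc k) * (2 * C)\<rfloor>"
        using C[of y] by (intro floor_mono mult_left_mono) auto
      then have "nat \<lfloor>real (Suc k) * (u y + C)\<rfloor> < r" by (simp add: r_def nat_mono le_imp_less_Suc)
      moreover have "y \<in> B (nat \<lfloor>real (Suc k) * (u y + C)\<rfloor>)" using y nn by (simp add: B_def)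
      ultimately show "y \<in> (\<Union>i<r. B i)" by blast
    qed (auto simp: B_def)
    have "(\<integral>\<omega>. (if card (\<Phi> \<omega>) = n then \<Prod>y\<in>\<Phi> \<omega>. v k y else 0) \<partial>\<Omega>) =
     (lam * (LINT y:W|lborel. v k y)) ^ n / fact n * exp (- (lam * measure lborel W))"
      by (rule ppp_prod_expectation_step[where B = B and r = r and c = "\<lambda>i. real i / real (Suc k) - C"])
        (use \<open>prob_space \<Omega>\<close> ppp W Bsets cover in \<open>auto simp: disjoint_family_on_def B_def v_def\<close>)
    moreover have "(\<integral>\<omega>. (if card (\<Phi> \<omega>) = n then \<Prod>y\<in>\<Phi> \<omega>. v k y else 0) \<partial>\<Omega>) =
      (\<integral>\<omega>. (if card (\<Phi> \<omega>) = n then \<Prod>j<n. v k (Y j \<omega>) else 0) \<partial>\<Omega>)"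
      by (intro Bochner_Integration.integral_cong refl) (auto simp: enumerates_prod[OF en])
    ultimately show ?thesis by simp
  qed
  have lim1: "(\<lambda>k. \<integral>\<omega>. (if card (\<Phi> \<omega>) = n then \<Prod>j<n. v k (Y j \<omega>) else 0) \<partial>\<Omega>) \<longlonglongrightarrow>
     (\<integral>\<omega>. (if card (\<Phi> \<omega>) = n then \<Prod>j<n. u (Y j \<omega>) else 0) \<partial>\<Omega>)"
  proof (rule integral_dominated_convergence[where w = "\<lambda>_. C ^ n"])
    show "AE \<omega> in \<Omega>. norm (if card (\<Phi> \<omega>) = n then \<Prod>j<n. v k (Y j \<omega>) else 0) \<le> C ^ n" for k
    proof (intro AE_I2)
      fix \<omega>
      have "\<bar>\<Prod>j<n. v k (Y j \<omega>)\<bar> \<le> (\<Prod>j<n. C)"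
        unfolding abs_prod by (intro prod_mono) (auto simp: vC)
      then show "norm (if card (\<Phi> \<omega>) = n then \<Prod>j<n. v k (Y j \<omega>) else 0) \<le> C ^ n"
        using C0 by auto
    qed
    show "AE \<omega> in \<Omega>. (\<lambda>k. if card (\<Phi> \<omega>) = n then \<Prod>j<n. v k (Y j \<omega>) else 0)
         \<longlonglongrightarrow> (if card (\<Phi> \<omega>) = n then \<Prod>j<n. u (Y j \<omega>) else 0)"
      by (intro AE_I2) (auto intro!: tendsto_prod vlim)
  qed measurable
  have lim2: "(\<lambda>k. LINT y:W|lborel. v k y) \<longlonglongrightarrow> (LINT y:W|lborel. u y)"
    unfolding set_lebesgue_integral_def
  proof (rule integral_dominated_convergence[where w = "\<lambda>y. C * indicator W y"])
    show "integrable lborel (\<lambda>y. C * indicator W y)" using fW by auto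
    show "AE y in lborel. (\<lambda>k. indicator W y *\<^sub>R v k y) \<longlonglongrightarrow> indicator W y *\<^sub>R u y"
      by (intro AE_I2 tendsto_intros vlim)
    show "AE y in lborel. norm (indicator W y *\<^sub>R v k y) \<le> C * indicator W y" for k
      by (intro AE_I2) (auto simp: indicator_def vC)
  qed measurable
  have "(\<lambda>k. \<integral>\<omega>. (if card (\<Phi> \<omega>) = n then \<Prod>j<n. v k (Y j \<omega>) else 0) \<partial>\<Omega>) \<longlonglongrightarrow>
     (lam * (LINT y:W|lborel. u y)) ^ n / fact n * exp (- (lam * measure lborel W))"
    unfolding step by (intro tendsto_intros lim2) auto
  with lim1 show ?thesis by (rule LIMSEQ_unique)
qed

text \<open>The integral of 1 + t h over the window is its measure plus t times the integral of h,
  so the right side is the coefficient of t^k in a binomial power. On the left, expanding the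
  product over the labels gives one term for each subset S, and those with card S = k carry
  t^k.\<close>

lemma ppp_subset_sums:
  fixes \<Phi> :: "'w \<Rightarrow> 'a::euclidean_space set" and h :: "'a \<Rightarrow> real"
  assumes "prob_space \<Omega>" and ppp: "homogeneous_ppp \<Omega> lam W \<Phi>" and en: "enumerates \<Omega> Y \<Phi>"
    and W: "W \<in> sets borel" "bounded W"
    and h[measurable]: "h \<in> borel_measurable borel" and C: "\<And>y. \<bar>h y\<bar> \<le> C"
  shows "(\<Sum>S | S \<subseteq> {..<n} \<and> card S = k.
            \<integral>\<omega>. (if card (\<Phi> \<omega>) = n then \<Prod>j\<in>S. h (Y j \<omega>) else 0) \<partial>\<Omega>) =
     real (n choose k) * (lam * (LINT y:W|lborel. h y)) ^ k * (lam * measure lborel W) ^ (n - k)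
       / fact n * exp (- (lam * measure lborel W))"
proof (cases "k \<le> n")
  case False
  then have "{S. S \<subseteq> {..<n} \<and> card S = k} = {}"
    using card_mono[of "{..<n}"] by force
  with False show ?thesis by (simp only: sum.empty) (simp add: binomial_eq_0)
next
  case kn: True
  interpret prob_space \<Omega> by fact
  have Y[measurable]: "Y j \<in> borel_measurable \<Omega>" for j using en by (auto simp: enumerates_def)
  note [measurable] = homogeneous_ppp_card(1)[OF ppp W] W(1)
  have fW: "emeasure lborel W < \<infinity>" using W emeasure_bounded_finite by blast
  have C0: "C \<ge> 0" using C[of 0] by linarith
  define G where "G S \<omega> = (if card (\<Phi> \<omega>) = n then \<Prod>j\<in>S. h (Y j \<omega>) else 0)" for S \<omega>
  have intG: "integrable \<Omega> (G S)" for S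
  proof (rule integrable_const_bound[where B="C ^ card S"])
    show "AE \<omega> in \<Omega>. norm (G S \<omega>) \<le> C ^ card S"
    proof (intro AE_I2)
      fix \<omega>
      have "\<bar>\<Prod>j\<in>S. h (Y j \<omega>)\<bar> \<le> (\<Prod>j\<in>S. C)"
        unfolding abs_prod by (intro prod_mono) (auto simp: C)
      then show "norm (G S \<omega>) \<le> C ^ card S" using C0 by (auto simp: G_def)
    qed
  qed (unfold G_def, measurable)
  have inth: "integrable lborel (\<lambda>y. indicator W y *\<^sub>R h y)"
    using set_integrable_bounded[OF W h C] by (simp add: set_integrable_def)
  have intW: "integrable lborel (indicator W :: 'a \<Rightarrow> real)" using fW by auto
  define mW where "mW = measure lborel W"
  define I where "I = (LINT y:W|lborel. h y)"
  have "(\<Sum>i\<le>n. (\<Sum>S | S \<subseteq> {..<n} \<and> card S = i. expectation (G S)) * t ^ i) =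
    (\<Sum>i\<le>n. (real (n choose i) * (lam * I) ^ i * (lam * mW) ^ (n - i) / fact n * exp (- (lam * mW))) * t ^ i)"
    for t
  proof -
    have "(\<integral>\<omega>. (if card (\<Phi> \<omega>) = n then \<Prod>j<n. 1 + t * h (Y j \<omega>) else 0) \<partial>\<Omega>) =
        (lam * (LINT y:W|lborel. 1 + t * h y)) ^ n / fact n * exp (- (lam * mW))"
      unfolding mW_def
    proof (rule ppp_prod_expectation[OF \<open>prob_space \<Omega>\<close> ppp en W, where C = "1 + \<bar>t\<bar> * C"])
      fix y
      have "\<bar>1 + t * h y\<bar> \<le> 1 + \<bar>t\<bar> * \<bar>h y\<bar>" by (auto simp: abs_mult[symmetric])
      also have "\<dots> \<le> 1 + \<bar>t\<bar> * C" using C by (intro add_left_mono mult_left_mono) auto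
      finally show "\<bar>1 + t * h y\<bar> \<le> 1 + \<bar>t\<bar> * C" .
    qed measurable
    also have "(LINT y:W|lborel. 1 + t * h y) = mW + t * I"
    proof -
      have "(LINT y:W|lborel. 1 + t * h y) =
          (LINT y|lborel. indicator W y + t * (indicator W y *\<^sub>R h y))"
        unfolding set_lebesgue_integral_def
        by (intro Bochner_Integration.integral_cong) (auto simp: algebra_simps)
      also have "\<dots> = (LINT y|lborel. indicator W y) + (LINT y|lborel. t * (indicator W y *\<^sub>R h y))"
        by (intro Bochner_Integration.integral_add intW integrable_mult_right inth)
      finally show ?thesis by (simp add: mW_def I_def set_lebesgue_integral_def)
    qed
    also have "(lam * (mW + t * I)) ^ n / fact n * exp (- (lam * mW)) =
      (\<Sum>i\<le>n. (real (n choose i) * (lam * I) ^ i * (lam * mW) ^ (n - i) / fact n * exp (- (lam * mW))) * t ^ i)"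
    proof -
      have "lam * (mW + t * I) = t * (lam * I) + lam * mW" by (simp add: algebra_simps)
      then show ?thesis
        by (simp only: binomial_ring sum_divide_distrib sum_distrib_right)
          (simp add: power_mult_distrib mult_ac)
    qed
    also have "(\<integral>\<omega>. (if card (\<Phi> \<omega>) = n then \<Prod>j<n. 1 + t * h (Y j \<omega>) else 0) \<partial>\<Omega>) =
        (\<integral>\<omega>. (\<Sum>S\<in>Pow {..<n}. t ^ card S * G S \<omega>) \<partial>\<Omega>)"
    proof (intro Bochner_Integration.integral_cong refl)
      fix \<omega>
      have "(\<Prod>j<n. 1 + t * h (Y j \<omega>)) = (\<Prod>j<n. t * h (Y j \<omega>) + 1)" by (simp add: add.commute)
      also have "\<dots> = (\<Sum>S\<in>Pow {..<n}. t ^ card S * (\<Prod>j\<in>S. h (Y j \<omega>)))"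
        by (subst prod_add) (simp_all add: prod.distrib)
      finally show "(if card (\<Phi> \<omega>) = n then \<Prod>j<n. 1 + t * h (Y j \<omega>) else 0) =
          (\<Sum>S\<in>Pow {..<n}. t ^ card S * G S \<omega>)" by (simp add: G_def)
    qed
    also have "\<dots> = (\<Sum>S\<in>Pow {..<n}. t ^ card S * expectation (G S))"
      using intG by simp
    also have "\<dots> = (\<Sum>i\<le>n. \<Sum>S\<in>{S. S \<in> Pow {..<n} \<and> card S = i}. t ^ card S * expectation (G S))"
      by (rule sum.group[symmetric]) (use card_mono[of "{..<n}"] in auto)
    also have "\<dots> = (\<Sum>i\<le>n. (\<Sum>S | S \<subseteq> {..<n} \<and> card S = i. expectation (G S)) * t ^ i)"
      by (intro sum.cong refl) (auto simp: sum_distrib_left sum_distrib_right mult_ac intro!: sum.cong)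
    finally show ?thesis .
  qed
  then have "\<forall>i\<le>n. (\<Sum>S | S \<subseteq> {..<n} \<and> card S = i. expectation (G S)) =
      real (n choose i) * (lam * I) ^ i * (lam * mW) ^ (n - i) / fact n * exp (- (lam * mW))"
    by (subst polyfun_eq_coeffs[symmetric]) blast
  with kn show ?thesis unfolding G_def I_def mW_def by blast
qed

section \<open>Independence of variables of different types\<close>

lemma indep_pair_prob:
  assumes "prob_space Q" "indep_pair Q N X N' X'" "A \<in> sets N" "B \<in> sets N'"
  shows "measure Q ((X -` A \<inter> space Q) \<inter> (X' -` B \<inter> space Q)) =
    measure Q (X -` A \<inter> space Q) * measure Q (X' -` B \<inter> space Q)"
proof -
  interpret prob_space Q by fact
  show ?thesis
    using assms(2)
    by (intro indep_setD[of "sets (vimage_algebra (space Q) X N)" "sets (vimage_algebra (space Q) X' N')"]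
        in_vimage_algebra assms(3,4)) (simp add: indep_pair_def)
qed

text \<open>Rectangles determine a product of \<sigma>-finite measures, and on rectangles the
  equation is independence. It gives access to Fubini for a vector of locations and a vector of
  marks.\<close>

lemma indep_pair_distr:
  assumes "prob_space Q" and ip: "indep_pair Q N X N' X'"
  shows "distr Q (N \<Otimes>\<^sub>M N') (\<lambda>\<omega>. (X \<omega>, X' \<omega>)) = distr Q N X \<Otimes>\<^sub>M distr Q N' X'"
proof -
  interpret prob_space Q by fact
  have [measurable]: "X \<in> measurable Q N" "X' \<in> measurable Q N'"
    using ip by (auto simp: indep_pair_def)
  interpret X: prob_space "distr Q N X" by (rule prob_space_distr) simp
  interpret X': prob_space "distr Q N' X'" by (rule prob_space_distr) simp
  show ?thesis
  proof (rule pair_measure_eqI[symmetric])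
    fix A B assume "A \<in> sets (distr Q N X)" "B \<in> sets (distr Q N' X')"
    then have AB[measurable]: "A \<in> sets N" "B \<in> sets N'" by auto
    have "(\<lambda>\<omega>. (X \<omega>, X' \<omega>)) -` (A \<times> B) \<inter> space Q = (X -` A \<inter> space Q) \<inter> (X' -` B \<inter> space Q)"
      by auto
    then show "emeasure (distr Q N X) A * emeasure (distr Q N' X') B =
        emeasure (distr Q (N \<Otimes>\<^sub>M N') (\<lambda>\<omega>. (X \<omega>, X' \<omega>))) (A \<times> B)"
      by (simp add: emeasure_distr emeasure_eq_measure indep_pair_prob[OF assms AB]
          ennreal_mult'')
  qed (simp_all add: X.sigma_finite_measure_axioms X'.sigma_finite_measure_axioms cong: sets_pair_measure_cong)
qed

text \<open>A preimage under the composition is a preimage under X of a preimage under f, so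
  composing can only shrink the generated \<sigma>-algebra.\<close>

lemma sigma_sets_vimage_comp_subset:
  assumes "f \<in> measurable N K" "X \<in> S \<rightarrow> space N"
  shows "sigma_sets S {(\<lambda>\<omega>. f (X \<omega>)) -` A \<inter> S |A. A \<in> sets K} \<subseteq> sets (vimage_algebra S X N)"
proof -
  have "(\<lambda>\<omega>. f (X \<omega>)) -` A \<inter> S \<in> sets (vimage_algebra S X N)" if "A \<in> sets K" for A
  proof -
    have "(\<lambda>\<omega>. f (X \<omega>)) -` A \<inter> S = X -` (f -` A \<inter> space N) \<inter> S"
      using assms(2) by auto
    then show ?thesis
      using measurable_sets[OF assms(1) that] by (simp only: in_vimage_algebra)
  qed
  then show ?thesis
    by (intro sets.sigma_sets_subset[of _ "vimage_algebra S X N", unfolded space_vimage_algebra]) blast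
qed

text \<open>Independence passes to smaller \<sigma>-algebras. Once both variables are mapped into a
  common type, \<open>indep_var\<close> and its product rule for expectations apply.\<close>

lemma indep_pair_compose:
  assumes "prob_space Q" and ip: "indep_pair Q N X N' X'"
    and f[measurable]: "f \<in> measurable N K" and f'[measurable]: "f' \<in> measurable N' K'"
  shows "prob_space.indep_var Q K (\<lambda>\<omega>. f (X \<omega>)) K' (\<lambda>\<omega>. f' (X' \<omega>))"
proof -
  interpret prob_space Q by fact
  have X[measurable]: "X \<in> measurable Q N" and X'[measurable]: "X' \<in> measurable Q N'"
    using ip by (auto simp: indep_pair_def)
  have ind: "indep_set (sets (vimage_algebra (space Q) X N)) (sets (vimage_algebra (space Q) X' N'))"
    using ip by (simp add: indep_pair_def)
  have "X \<in> space Q \<rightarrow> space N" "X' \<in> space Q \<rightarrow> space N'"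
    using measurable_space[OF X] measurable_space[OF X'] by auto
  note sub = sigma_sets_vimage_comp_subset[OF f this(1)] sigma_sets_vimage_comp_subset[OF f' this(2)]
  show ?thesis
    unfolding indep_var_eq
  proof (intro conjI)
    show "indep_set (sigma_sets (space Q) {(\<lambda>\<omega>. f (X \<omega>)) -` A \<inter> space Q |A. A \<in> sets K})
        (sigma_sets (space Q) {(\<lambda>\<omega>. f' (X' \<omega>)) -` A \<inter> space Q |A. A \<in> sets K'})"
      using ind sub unfolding indep_sets2_eq by blast
  qed measurable
qed

section \<open>Conditioning on an event of positive probability\<close>

lemma integral_uniform_measure:
  fixes f :: "'a \<Rightarrow> real"
  assumes "prob_space M" and E: "measure M E > 0" and f[measurable]: "f \<in> borel_measurable M"
  shows "(\<integral>\<omega>. f \<omega> \<partial>uniform_measure M E) = (\<integral>\<omega>. indicator E \<omega> * f \<omega> \<partial>M) / measure M E"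
proof -
  interpret prob_space M by fact
  \<comment> \<open>\<open>measure\<close> is 0 outside the \<sigma>-algebra, so the positive value
    already makes E an event.\<close>
  have [measurable]: "E \<in> sets M" using E measure_notin_sets by fastforce
  have "indicator E \<omega> / emeasure M E = ennreal (indicator E \<omega> / measure M E)" for \<omega>
    using E by (auto simp: emeasure_eq_measure divide_ennreal indicator_def simp flip: ennreal_1)
  then have "uniform_measure M E = density M (\<lambda>\<omega>. ennreal (indicator E \<omega> / measure M E))"
    by (simp add: uniform_measure_def)
  then have "(\<integral>\<omega>. f \<omega> \<partial>uniform_measure M E) = (\<integral>\<omega>. (indicator E \<omega> / measure M E) *\<^sub>R f \<omega> \<partial>M)"
    by (simp add: integral_density)
  also have "\<dots> = (\<integral>\<omega>. (indicator E \<omega> * f \<omega>) / measure M E \<partial>M)"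
    by (intro Bochner_Integration.integral_cong) auto
  finally show ?thesis by simp
qed

lemma prob_space_uniform_measureI:
  assumes "prob_space M" "measure M E > 0"
  shows "prob_space (uniform_measure M E)"
proof -
  interpret prob_space M by fact
  show ?thesis using assms(2) by (intro prob_space_uniform_measure) (auto simp: emeasure_eq_measure)
qed

lemma measure_uniform_measure_prob:
  assumes "prob_space M" "measure M E > 0" "B \<in> sets M"
  shows "measure (uniform_measure M E) B = measure M (E \<inter> B) / measure M E"
proof -
  interpret prob_space M by fact
  show ?thesis using assms(2,3) by (intro measure_uniform_measure) (auto simp: emeasure_eq_measure)
qed

text \<open>Fubini with the locations fixed first: for a given vector y of locations the event is a
  box in the space of marks, whose probability is the product of the \<open>h (y j)\<close> because
  the marks are independent. This product is then averaged over the law of the locations.\<close>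

lemma indep_marks_prob:
  fixes Y :: "nat \<Rightarrow> 'w \<Rightarrow> 'a::euclidean_space" and G :: "nat \<Rightarrow> 'w \<Rightarrow> real"
  assumes "prob_space Q" and S: "S \<subseteq> {..<n}" "S \<noteq> {}"
    and ind: "prob_space.indep_vars Q (\<lambda>_. borel) G S"
    and ip: "indep_pair Q (\<Pi>\<^sub>M j\<in>{..<n}. borel) (\<lambda>\<omega>. \<lambda>j\<in>{..<n}. Y j \<omega>)
       (\<Pi>\<^sub>M j\<in>S. borel) (\<lambda>\<omega>. \<lambda>j\<in>S. G j \<omega>)"
    and R[measurable]: "Measurable.pred (borel \<Otimes>\<^sub>M borel) (\<lambda>(y, t). R y t)"
    and h[measurable]: "h \<in> borel_measurable borel"
    and hR: "\<And>j y. j \<in> S \<Longrightarrow> measure Q {\<omega>\<in>space Q. R y (G j \<omega>)} = h y"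
  shows "measure Q {\<omega>\<in>space Q. \<forall>j\<in>S. R (Y j \<omega>) (G j \<omega>)} = (\<integral>\<omega>. (\<Prod>j\<in>S. h (Y j \<omega>)) \<partial>Q)"
proof -
  interpret prob_space Q by fact
  have finS[simp]: "finite S" using S finite_subset by auto
  \<comment> \<open>One label suffices to recognize \<open>h y\<close> as a probability, hence as a
    number between 0 and 1.\<close>
  obtain j0 where "j0 \<in> S" using S by auto
  have h0: "0 \<le> h y" and h1: "h y \<le> 1" for y
    using hR[OF \<open>j0 \<in> S\<close>, of y, symmetric] by auto
  let ?N = "\<Pi>\<^sub>M j\<in>{..<n}. borel :: 'a measure" and ?N' = "\<Pi>\<^sub>M j\<in>S. borel :: real measure"
  let ?Y = "\<lambda>\<omega>. \<lambda>j\<in>{..<n}. Y j \<omega>" and ?G = "\<lambda>\<omega>. \<lambda>j\<in>S. G j \<omega>"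
  have mY[measurable]: "?Y \<in> measurable Q ?N" and mG[measurable]: "?G \<in> measurable Q ?N'"
    using ip by (auto simp: indep_pair_def)
  have Gj[measurable]: "G j \<in> borel_measurable Q" if "j \<in> S" for j
    using ind that by (auto simp: indep_vars_def)
  have Yj[measurable]: "Y j \<in> borel_measurable Q" if "j \<in> S" for j
  proof -
    have "(\<lambda>\<omega>. ?Y \<omega> j) \<in> borel_measurable Q"
      using that S by (intro measurable_compose[OF mY] measurable_component_singleton) auto
    then show ?thesis using that S by (auto cong: measurable_cong)
  qed
  define A where "A = {z\<in>space (?N \<Otimes>\<^sub>M ?N'). \<forall>j\<in>S. R (fst z j) (snd z j)}"
  have cmp: "(\<lambda>z. (fst z j, snd z j)) \<in> measurable (?N \<Otimes>\<^sub>M ?N') (borel \<Otimes>\<^sub>M borel)" if "j \<in> S" for j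
    using that S by (intro measurable_Pair measurable_compose[OF measurable_fst]
      measurable_compose[OF measurable_snd] measurable_component_singleton) auto
  have "Measurable.pred (?N \<Otimes>\<^sub>M ?N') (\<lambda>z. R (fst z j) (snd z j))" if "j \<in> S" for j
    using measurable_compose[OF cmp[OF that] R] by simp
  then have [measurable]: "A \<in> sets (?N \<Otimes>\<^sub>M ?N')"
    unfolding A_def by (intro sets.sets_Collect_finite_All) auto
  interpret X': prob_space "distr Q ?N' ?G" by (rule prob_space_distr) simp
  have RyG: "{t. R y t} \<in> sets borel" for y
  proof -
    have "(\<lambda>t. (y, t)) \<in> measurable borel (borel \<Otimes>\<^sub>M borel)" by measurable
    from measurable_compose[OF this R] show ?thesis by (simp add: pred_def)
  qed
  have inner: "emeasure (distr Q ?N' ?G) (Pair y -` A) = ennreal (\<Prod>j\<in>S. h (y j))" if "y \<in> space ?N" for y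
  proof -
    have "emeasure (distr Q ?N' ?G) (Pair y -` A) = emeasure Q (?G -` (Pair y -` A) \<inter> space Q)"
      using sets_Pair1[of A ?N ?N' y] by (intro emeasure_distr) auto
    also have "?G -` (Pair y -` A) \<inter> space Q = (\<Inter>j\<in>S. G j -` {t. R (y j) t} \<inter> space Q)"
      using that measurable_space[OF mG] S(2) by (auto simp: A_def space_pair_measure)
    also have "emeasure Q \<dots> = ennreal (\<Prod>j\<in>S. prob (G j -` {t. R (y j) t} \<inter> space Q))"
      using RyG unfolding emeasure_eq_measure by (subst indep_varsD_finite[OF ind S(2) finS]) auto
    also have "(\<Prod>j\<in>S. prob (G j -` {t. R (y j) t} \<inter> space Q)) = (\<Prod>j\<in>S. h (y j))"
    proof (intro prod.cong refl)
      fix j assume "j \<in> S"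
      have "G j -` {t. R (y j) t} \<inter> space Q = {\<omega>\<in>space Q. R (y j) (G j \<omega>)}" by auto
      then show "prob (G j -` {t. R (y j) t} \<inter> space Q) = h (y j)" using hR[OF \<open>j \<in> S\<close>] by simp
    qed
    finally show ?thesis .
  qed
  have "emeasure Q {\<omega>\<in>space Q. \<forall>j\<in>S. R (Y j \<omega>) (G j \<omega>)} =
      emeasure (distr Q (?N \<Otimes>\<^sub>M ?N') (\<lambda>\<omega>. (?Y \<omega>, ?G \<omega>))) A"
  proof -
    have "{\<omega>\<in>space Q. \<forall>j\<in>S. R (Y j \<omega>) (G j \<omega>)} = (\<lambda>\<omega>. (?Y \<omega>, ?G \<omega>)) -` A \<inter> space Q"
      using measurable_space[OF mY] measurable_space[OF mG] S
      by (auto simp: A_def space_pair_measure subset_eq)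
    then show ?thesis by (simp add: emeasure_distr)
  qed
  also have "\<dots> = emeasure (distr Q ?N ?Y \<Otimes>\<^sub>M distr Q ?N' ?G) A"
    by (simp add: indep_pair_distr[OF \<open>prob_space Q\<close> ip])
  also have "\<dots> = (\<integral>\<^sup>+y. emeasure (distr Q ?N' ?G) (Pair y -` A) \<partial>distr Q ?N ?Y)"
    by (rule X'.emeasure_pair_measure_alt) (simp cong: sets_pair_measure_cong)
  also have "\<dots> = (\<integral>\<^sup>+y. ennreal (\<Prod>j\<in>S. h (y j)) \<partial>distr Q ?N ?Y)"
    by (intro nn_integral_cong inner) simp
  also have "\<dots> = (\<integral>\<^sup>+\<omega>. ennreal (\<Prod>j\<in>S. h (?Y \<omega> j)) \<partial>Q)"
  proof (rule nn_integral_distr[OF mY])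
    have "(\<lambda>y. h (y j)) \<in> borel_measurable ?N" if "j \<in> S" for j
      using that S by (intro measurable_compose[OF _ h] measurable_component_singleton) auto
    then show "(\<lambda>y. ennreal (\<Prod>j\<in>S. h (y j))) \<in> borel_measurable (distr Q ?N ?Y)" by simp
  qed
  also have "\<dots> = (\<integral>\<^sup>+\<omega>. ennreal (\<Prod>j\<in>S. h (Y j \<omega>)) \<partial>Q)"
    using S by (intro nn_integral_cong arg_cong[where f=ennreal] prod.cong) auto
  also have "\<dots> = ennreal (\<integral>\<omega>. (\<Prod>j\<in>S. h (Y j \<omega>)) \<partial>Q)"
  proof (rule nn_integral_eq_integral)
    show "integrable Q (\<lambda>\<omega>. \<Prod>j\<in>S. h (Y j \<omega>))"
      by (intro integrable_const_bound[where B=1] AE_I2)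
        (auto simp: abs_prod h0 intro!: prod_le_1 h1)
  qed (auto intro!: prod_nonneg h0)
  finally show ?thesis
    by (simp add: emeasure_eq_measure integral_nonneg_AE prod_nonneg h0)
qed

lemma indep_bernoulli_pattern_prob:
  assumes "prob_space Q" and ind: "prob_space.indep_vars Q (\<lambda>_. count_space UNIV) B {..<n}"
    and p: "\<And>j. j < n \<Longrightarrow> measure Q {\<omega>\<in>space Q. B j \<omega>} = p"
    and S: "S \<subseteq> {..<n}"
  shows "measure Q {\<omega>\<in>space Q. {j\<in>{..<n}. B j \<omega>} = S} = p ^ card S * (1 - p) ^ (n - card S)"
proof -
  interpret prob_space Q by fact
  show ?thesis
  \<comment> \<open>For n = 0 the intersection over the labels would be \<open>UNIV\<close> instead
    of the space; the product rule needs a nonempty index set.\<close>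
  proof (cases "n = 0")
    case True
    then show ?thesis using S by (simp add: prob_space)
  next
    case False
    have [measurable]: "B j \<in> measurable Q (count_space UNIV)" if "j < n" for j
      using ind that by (auto simp: indep_vars_def)
    have "{\<omega>\<in>space Q. {j\<in>{..<n}. B j \<omega>} = S} = (\<Inter>j\<in>{..<n}. B j -` {j \<in> S} \<inter> space Q)"
      using S False by auto
    also have "prob \<dots> = (\<Prod>j<n. prob (B j -` {j \<in> S} \<inter> space Q))"
      using False by (intro indep_varsD_finite[OF ind]) auto
    also have "\<dots> = (\<Prod>j<n. if j \<in> S then p else 1 - p)"
    proof (intro prod.cong refl)
      fix j assume "j \<in> {..<n}"
      then have j: "j < n" by simp
      have "B j -` {True} \<inter> space Q = {\<omega>\<in>space Q. B j \<omega>}"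
        "B j -` {False} \<inter> space Q = space Q - {\<omega>\<in>space Q. B j \<omega>}" by auto
      moreover have "{\<omega>\<in>space Q. B j \<omega>} \<in> events" using j by measurable
      ultimately show "prob (B j -` {j \<in> S} \<inter> space Q) = (if j \<in> S then p else 1 - p)"
        using p[of j] j by (cases "j \<in> S") (auto simp: prob_compl)
    qed
    also have "\<dots> = p ^ card S * (1 - p) ^ (n - card S)"
      using S by (subst prod.If_cases) (auto simp: Int_absorb1 card_Diff_subset finite_subset
        simp flip: Diff_eq)
    finally show ?thesis .
  qed
qed

section \<open>Thinned and marked Poisson processes\<close>

text \<open>The window stays general: only its measure and the integral of one function over it
  enter the conditional probability, so the geometry of the disk is postponed.\<close>

locale marked_ppp = prob_space \<Omega>
  for \<Omega> :: "'w measure" +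
  fixes lam p :: real and M :: nat and W :: "'a::euclidean_space set"
    and \<Phi> \<Psi> :: "'w \<Rightarrow> 'a set" and Y :: "nat \<Rightarrow> 'w \<Rightarrow> 'a" and g :: "'w \<Rightarrow> 'a \<Rightarrow> real"
  assumes lam: "lam > 0" and p: "0 < p" "p \<le> 1"
    and W: "W \<in> sets borel" "bounded W" "measure lborel W > 0"
    and ppp: "homogeneous_ppp \<Omega> lam W \<Phi>"
    and en: "enumerates \<Omega> Y \<Phi>"
    and thin: "independent_thinning \<Omega> p Y \<Phi> \<Psi>"
    and gains: "iid_gains \<Omega> M Y \<Phi> \<Psi> g"
begin

definition mass :: "nat \<Rightarrow> real" where
  "mass n = (lam * measure lborel W) ^ n / fact n * exp (- (lam * measure lborel W))"

text \<open>On a pattern the number of points and the labels of the retained points are fixed. The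
  random index set of the gains thereby becomes a deterministic set S, as in the hypothesis on the
  gains.\<close>

definition pattern :: "nat \<Rightarrow> nat set \<Rightarrow> 'w set" where
  "pattern n S = {\<omega>\<in>space \<Omega>. card (\<Phi> \<omega>) = n \<and> {j\<in>{..<n}. Y j \<omega> \<in> \<Psi> \<omega>} = S}"

lemma measurable_card [measurable]: "(\<lambda>\<omega>. card (\<Phi> \<omega>)) \<in> measurable \<Omega> (count_space UNIV)"
  by (rule homogeneous_ppp_card[OF ppp W(1,2)])

lemma measurable_Y [measurable]: "Y j \<in> borel_measurable \<Omega>"
  using en by (auto simp: enumerates_def)

lemma prob_card: "prob {\<omega>\<in>space \<Omega>. card (\<Phi> \<omega>) = n} = mass n"
  unfolding mass_def by (rule homogeneous_ppp_card[OF ppp W(1,2)])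

lemma mass_pos: "mass n > 0"
  using lam W by (simp add: mass_def)

text \<open>All Poisson weights are positive, so the guard in \<open>independent_thinning\<close> is
  met for every n.\<close>

lemma thinning_given_card:
  defines "Q \<equiv> \<lambda>n. uniform_measure \<Omega> {\<omega>\<in>space \<Omega>. card (\<Phi> \<omega>) = n}"
  shows "prob_space.indep_vars (Q n) (\<lambda>_. count_space UNIV) (\<lambda>j \<omega>. Y j \<omega> \<in> \<Psi> \<omega>) {..<n}"
    and "j < n \<Longrightarrow> measure (Q n) {\<omega>\<in>space (Q n). Y j \<omega> \<in> \<Psi> \<omega>} = p"
    and "indep_pair (Q n) (\<Pi>\<^sub>M j\<in>{..<n}. borel) (\<lambda>\<omega>. \<lambda>j\<in>{..<n}. Y j \<omega>)
            (\<Pi>\<^sub>M j\<in>{..<n}. count_space UNIV) (\<lambda>\<omega>. \<lambda>j\<in>{..<n}. Y j \<omega> \<in> \<Psi> \<omega>)"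
  using thin mass_pos[of n]
  unfolding independent_thinning_def Let_def prob_card[symmetric] Q_def by blast+

lemma prob_space_given_card: "prob_space (uniform_measure \<Omega> {\<omega>\<in>space \<Omega>. card (\<Phi> \<omega>) = n})"
  by (rule prob_space_uniform_measureI) (simp_all add: prob_card mass_pos prob_space_axioms)

text \<open>Label j belongs to the independent family given j + 1 points. Conditioning changes the
  measure but not the \<sigma>-algebra, so measurability carries over to \<Omega>.\<close>

lemma measurable_retained [measurable]: "Measurable.pred \<Omega> (\<lambda>\<omega>. Y j \<omega> \<in> \<Psi> \<omega>)"
proof -
  interpret Q: prob_space "uniform_measure \<Omega> {\<omega>\<in>space \<Omega>. card (\<Phi> \<omega>) = Suc j}"
    by (rule prob_space_given_card)
  have "(\<lambda>\<omega>. Y j \<omega> \<in> \<Psi> \<omega>) \<in> measurable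
      (uniform_measure \<Omega> {\<omega>\<in>space \<Omega>. card (\<Phi> \<omega>) = Suc j}) (count_space UNIV)"
    using thinning_given_card(1)[of "Suc j"] unfolding Q.indep_vars_def by blast
  also have "measurable (uniform_measure \<Omega> {\<omega>\<in>space \<Omega>. card (\<Phi> \<omega>) = Suc j}) (count_space UNIV) =
      measurable \<Omega> (count_space UNIV :: bool measure)"
    by (intro measurable_cong_sets) auto
  finally show ?thesis .
qed

lemma sets_pattern [measurable]: "pattern n S \<in> events"
proof -
  have "pattern n S = {\<omega>\<in>space \<Omega>. card (\<Phi> \<omega>) = n \<and> (\<forall>j\<in>{..<n}. Y j \<omega> \<in> \<Psi> \<omega> \<longleftrightarrow> j \<in> S) \<and> S \<subseteq> {..<n}}"
    by (auto simp: pattern_def)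
  then show ?thesis by simp
qed

text \<open>Given n points, the retention indicators are independent of the locations, so the
  pattern contributes only its Bernoulli weight. No law of the labelled points is used, and F need
  not be symmetric.\<close>

lemma integral_pattern:
  fixes F :: "(nat \<Rightarrow> 'a) \<Rightarrow> real"
  assumes S: "S \<subseteq> {..<n}" and F[measurable]: "F \<in> borel_measurable (\<Pi>\<^sub>M j\<in>{..<n}. borel)"
    and C: "\<And>y. \<bar>F y\<bar> \<le> C"
  shows "(\<integral>\<omega>. indicator (pattern n S) \<omega> * F (\<lambda>j\<in>{..<n}. Y j \<omega>) \<partial>\<Omega>) =
    p ^ card S * (1 - p) ^ (n - card S) *
      (\<integral>\<omega>. (if card (\<Phi> \<omega>) = n then F (\<lambda>j\<in>{..<n}. Y j \<omega>) else 0) \<partial>\<Omega>)"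
proof -
  define E where "E = {\<omega>\<in>space \<Omega>. card (\<Phi> \<omega>) = n}"
  have PE: "prob E > 0" by (simp add: E_def prob_card mass_pos)
  define Q where "Q = uniform_measure \<Omega> E"
  interpret Q: prob_space Q unfolding Q_def E_def by (rule prob_space_given_card)
  have [simp]: "space Q = space \<Omega>" "sets Q = sets \<Omega>" by (auto simp: Q_def)
  have [measurable_cong]: "sets Q = sets \<Omega>" by simp
  note thin = thinning_given_card[where n=n, folded E_def, folded Q_def]
  let ?F = "\<lambda>\<omega>. F (\<lambda>j\<in>{..<n}. Y j \<omega>)"
  let ?I = "\<lambda>\<omega>. indicator {\<omega>. {j\<in>{..<n}. Y j \<omega> \<in> \<Psi> \<omega>} = S} \<omega> :: real"
  have mF: "?F \<in> borel_measurable \<Omega>"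
    by (rule measurable_compose[OF _ F]) measurable
  \<comment> \<open>The pattern is expressed by a real function of the vector of indicators, which
    puts it into the same type as F.\<close>
  have "Q.indep_var borel ?F borel
     (\<lambda>\<omega>. (\<lambda>b. if \<forall>j\<in>{..<n}. b j \<longleftrightarrow> j \<in> S then 1 else 0 :: real) (\<lambda>j\<in>{..<n}. Y j \<omega> \<in> \<Psi> \<omega>))"
    by (rule indep_pair_compose[OF Q.prob_space_axioms thin(3)]) measurable
  also have "(\<lambda>\<omega>. (\<lambda>b. if \<forall>j\<in>{..<n}. b j \<longleftrightarrow> j \<in> S then 1 else 0 :: real) (\<lambda>j\<in>{..<n}. Y j \<omega> \<in> \<Psi> \<omega>)) = ?I"
    using S by (auto simp: fun_eq_iff indicator_def)
  finally have ind: "Q.indep_var borel ?F borel ?I" .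
  have mI: "?I \<in> borel_measurable \<Omega>"
    using ind unfolding Q.indep_var_eq by (auto cong: measurable_cong_sets)
  have intF: "integrable Q ?F"
    using mF C by (intro Q.integrable_const_bound[where B=C]) auto
  have intI: "integrable Q ?I"
    using mI by (intro Q.integrable_const_bound[where B=1]) auto
  have EI: "Q.expectation ?I = p ^ card S * (1 - p) ^ (n - card S)"
  proof -
    have "Q.expectation ?I = Q.prob ({\<omega>. {j\<in>{..<n}. Y j \<omega> \<in> \<Psi> \<omega>} = S} \<inter> space Q)"
      by (rule Bochner_Integration.integral_indicator)
    also have "{\<omega>. {j\<in>{..<n}. Y j \<omega> \<in> \<Psi> \<omega>} = S} \<inter> space Q =
        {\<omega>\<in>space Q. {j\<in>{..<n}. Y j \<omega> \<in> \<Psi> \<omega>} = S}" by auto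
    finally show ?thesis
      using indep_bernoulli_pattern_prob[OF Q.prob_space_axioms thin(1,2) S] by simp
  qed
  have "(\<integral>\<omega>. indicator (pattern n S) \<omega> * ?F \<omega> \<partial>\<Omega>) = (\<integral>\<omega>. indicator E \<omega> * (?F \<omega> * ?I \<omega>) \<partial>\<Omega>)"
    by (intro Bochner_Integration.integral_cong) (auto simp: pattern_def E_def indicator_def)
  also have "\<dots> = (\<integral>\<omega>. ?F \<omega> * ?I \<omega> \<partial>Q) * prob E"
    using PE mF mI unfolding Q_def
    by (subst integral_uniform_measure[OF prob_space_axioms PE]) auto
  also have "(\<integral>\<omega>. ?F \<omega> * ?I \<omega> \<partial>Q) = Q.expectation ?F * Q.expectation ?I"
    by (rule Q.indep_var_lebesgue_integral[OF ind intF intI])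
  also have "Q.expectation ?F = (\<integral>\<omega>. indicator E \<omega> * ?F \<omega> \<partial>\<Omega>) / prob E"
    unfolding Q_def by (rule integral_uniform_measure[OF prob_space_axioms PE mF])
  also have "(\<integral>\<omega>. indicator E \<omega> * ?F \<omega> \<partial>\<Omega>) = (\<integral>\<omega>. (if card (\<Phi> \<omega>) = n then ?F \<omega> else 0) \<partial>\<Omega>)"
    by (intro Bochner_Integration.integral_cong) (auto simp: E_def indicator_def)
  \<comment> \<open>The division comes from the conditional mean of F, the multiplication from
    undoing the conditioning of the product F times indicator.\<close>
  also have "\<And>a c. a / prob E * c * prob E = c * a" using PE by simp
  finally show ?thesis unfolding EI .
qed

lemma prob_pattern:
  assumes S: "S \<subseteq> {..<n}"
  shows "prob (pattern n S) = p ^ card S * (1 - p) ^ (n - card S) * mass n"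
proof -
  have "(\<integral>\<omega>. (if card (\<Phi> \<omega>) = n then 1 else 0 :: real) \<partial>\<Omega>) =
      expectation (indicator {\<omega>\<in>space \<Omega>. card (\<Phi> \<omega>) = n})"
    by (intro Bochner_Integration.integral_cong) (auto simp: indicator_def)
  then have "(\<integral>\<omega>. (if card (\<Phi> \<omega>) = n then 1 else 0 :: real) \<partial>\<Omega>) = mass n"
    by (simp add: prob_card)
  moreover have "(\<integral>\<omega>. indicator (pattern n S) \<omega> \<partial>\<Omega>) = prob (pattern n S)" by simp
  ultimately show ?thesis
    using integral_pattern[OF S, of "\<lambda>_. 1" 1] by simp
qed

text \<open>Retaining all points has positive probability even if \<open>p = 1\<close>, so the gain of every label is
  measurable although the hypothesis says nothing about null patterns.\<close>

lemma measurable_gain: "(\<lambda>\<omega>. g \<omega> (Y j \<omega>)) \<in> borel_measurable \<Omega>"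
proof -
  have pos: "prob (pattern (Suc j) {..<Suc j}) > 0"
    using p mass_pos by (simp add: prob_pattern)
  define Q where "Q = uniform_measure \<Omega> (pattern (Suc j) {..<Suc j})"
  interpret Q: prob_space Q
    unfolding Q_def by (rule prob_space_uniform_measureI[OF prob_space_axioms pos])
  have "Q.indep_vars (\<lambda>_. borel) (\<lambda>j \<omega>. g \<omega> (Y j \<omega>)) {..<Suc j}"
    using gains[unfolded iid_gains_def Let_def, rule_format, of "{..<Suc j}" "Suc j"] pos
    by (simp add: pattern_def Q_def)
  then have "(\<lambda>\<omega>. g \<omega> (Y j \<omega>)) \<in> borel_measurable Q"
    unfolding Q.indep_vars_def by blast
  then show ?thesis by (simp add: Q_def cong: measurable_cong_sets)
qed

text \<open>For t \<ge> 0 this is the distribution function of the gamma law with shape M - l + 1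
  and unit rate; the sum is the probability that a Poisson variable with mean t is at most M -
  l.\<close>

definition gain_cdf :: "nat \<Rightarrow> real \<Rightarrow> real" where
  "gain_cdf l t = 1 - (\<Sum>m=0..M - l. t ^ m / fact m * exp (- t))"

text \<open>Two averages in turn: given the pattern, the gains are integrated out and leave the
  product of h over the locations; then \<open>integral_pattern\<close> integrates out the pattern.
  The value \<open>h 0 = 1\<close> matches the alternative \<open>Y j \<omega> = 0\<close>: a point
  at the origin puts no condition on its gain.\<close>

lemma prob_pattern_gains:
  fixes \<tau> :: "'a \<Rightarrow> real"
  assumes S: "S \<subseteq> {..<n}" "S \<noteq> {}" and [measurable]: "\<tau> \<in> borel_measurable borel" and \<tau>: "\<And>y. \<tau> y \<ge> 0"
  defines "h \<equiv> \<lambda>y. if y = 0 then 1 else gain_cdf (min M n) (\<tau> y)"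
  assumes h1: "\<And>y. \<bar>h y\<bar> \<le> 1"
  shows "prob {\<omega>\<in>pattern n S. \<forall>j\<in>S. Y j \<omega> = 0 \<or> g \<omega> (Y j \<omega>) \<le> \<tau> (Y j \<omega>)} =
    p ^ card S * (1 - p) ^ (n - card S) *
      (\<integral>\<omega>. (if card (\<Phi> \<omega>) = n then \<Prod>j\<in>S. h (Y j \<omega>) else 0) \<partial>\<Omega>)" (is "prob ?A = _")
proof -
  have finS[simp]: "finite S" using S finite_subset by auto
  note [measurable] = measurable_gain
  have hm[measurable]: "h \<in> borel_measurable borel" unfolding h_def gain_cdf_def by measurable
  define E where "E = pattern n S"
  have "prob ?A = (\<integral>\<omega>. indicator E \<omega> * (\<Prod>j\<in>S. h (Y j \<omega>)) \<partial>\<Omega>)"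
  proof (cases "prob E > 0")
    case True
    define Q where "Q = uniform_measure \<Omega> E"
    interpret Q: prob_space Q
      unfolding Q_def by (rule prob_space_uniform_measureI[OF prob_space_axioms True])
    have [simp]: "space Q = space \<Omega>" "sets Q = sets \<Omega>" by (auto simp: Q_def)
    have [measurable_cong]: "sets Q = sets \<Omega>" by simp
    have gn: "Q.indep_vars (\<lambda>_. borel) (\<lambda>j \<omega>. g \<omega> (Y j \<omega>)) S"
      "\<And>j t. j \<in> S \<Longrightarrow> t \<ge> 0 \<Longrightarrow> measure Q {\<omega>\<in>space Q. g \<omega> (Y j \<omega>) > t} = 1 - gain_cdf (min M n) t"
      "indep_pair Q (\<Pi>\<^sub>M j\<in>{..<n}. borel) (\<lambda>\<omega>. \<lambda>j\<in>{..<n}. Y j \<omega>)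
            (\<Pi>\<^sub>M j\<in>S. borel) (\<lambda>\<omega>. \<lambda>j\<in>S. g \<omega> (Y j \<omega>))"
      using gains[unfolded iid_gains_def Let_def, rule_format, OF S(1)] True
      by (simp_all add: pattern_def Q_def E_def gain_cdf_def)
    have "Q.prob {\<omega>\<in>space Q. \<forall>j\<in>S. Y j \<omega> = 0 \<or> g \<omega> (Y j \<omega>) \<le> \<tau> (Y j \<omega>)} =
        Q.expectation (\<lambda>\<omega>. \<Prod>j\<in>S. h (Y j \<omega>))"
    proof (rule indep_marks_prob[OF Q.prob_space_axioms S gn(1,3), where R="\<lambda>y t. y = 0 \<or> t \<le> \<tau> y"])
      fix j y assume j: "j \<in> S"
      have "{\<omega>\<in>space Q. g \<omega> (Y j \<omega>) \<le> \<tau> y} = space Q - {\<omega>\<in>space Q. g \<omega> (Y j \<omega>) > \<tau> y}" by auto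
      also have "Q.prob \<dots> = gain_cdf (min M n) (\<tau> y)"
        using gn(2)[OF j \<tau>[of y]] by (subst Q.prob_compl) (auto simp: Q_def)
      finally show "Q.prob {\<omega>\<in>space Q. y = 0 \<or> g \<omega> (Y j \<omega>) \<le> \<tau> y} = h y"
        using Q.prob_space by (auto simp: h_def)
    qed measurable
    also have "\<dots> = (\<integral>\<omega>. indicator E \<omega> * (\<Prod>j\<in>S. h (Y j \<omega>)) \<partial>\<Omega>) / prob E"
      unfolding Q_def by (rule integral_uniform_measure[OF prob_space_axioms True]) measurable
    also have "Q.prob {\<omega>\<in>space Q. \<forall>j\<in>S. Y j \<omega> = 0 \<or> g \<omega> (Y j \<omega>) \<le> \<tau> (Y j \<omega>)} =
        prob (E \<inter> {\<omega>\<in>space \<Omega>. \<forall>j\<in>S. Y j \<omega> = 0 \<or> g \<omega> (Y j \<omega>) \<le> \<tau> (Y j \<omega>)}) / prob E"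
      unfolding Q_def space_uniform_measure
      by (rule measure_uniform_measure_prob[OF prob_space_axioms True]) measurable
    also have "E \<inter> {\<omega>\<in>space \<Omega>. \<forall>j\<in>S. Y j \<omega> = 0 \<or> g \<omega> (Y j \<omega>) \<le> \<tau> (Y j \<omega>)} = ?A"
      by (auto simp: E_def pattern_def)
    finally show ?thesis using True by simp
  next
    \<comment> \<open>Null patterns occur when p = 1 and S is not all of \<open>{..<n}\<close>. The
      hypothesis on the gains is silent there, but both sides vanish.\<close>
    case False
    then have zero: "prob E = 0" using measure_nonneg[of \<Omega> E] by linarith
    have "prob ?A \<le> prob E" unfolding E_def by (rule finite_measure_mono) auto
    then have "prob ?A = 0" using zero measure_nonneg[of \<Omega> ?A] by linarith
    moreover have "AE \<omega> in \<Omega>. \<omega> \<notin> E"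
      using zero by (intro AE_not_in) (auto simp: E_def emeasure_eq_measure intro!: null_setsI)
    then have "(\<integral>\<omega>. indicator E \<omega> * (\<Prod>j\<in>S. h (Y j \<omega>)) \<partial>\<Omega>) = 0"
      by (intro integral_eq_zero_AE) auto
    ultimately show ?thesis by simp
  qed
  also have "\<dots> = (\<integral>\<omega>. indicator (pattern n S) \<omega> * (\<Prod>j\<in>S. h ((\<lambda>j\<in>{..<n}. Y j \<omega>) j)) \<partial>\<Omega>)"
    using S unfolding E_def
    by (intro Bochner_Integration.integral_cong refl arg_cong2[where f="(*)"] prod.cong) auto
  also have "\<dots> = p ^ card S * (1 - p) ^ (n - card S) *
      (\<integral>\<omega>. (if card (\<Phi> \<omega>) = n then (\<Prod>j\<in>S. h ((\<lambda>j\<in>{..<n}. Y j \<omega>) j)) else 0) \<partial>\<Omega>)"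
  proof (rule integral_pattern[OF S(1), where C=1])
    show "(\<lambda>y. \<Prod>j\<in>S. h (y j)) \<in> borel_measurable (\<Pi>\<^sub>M j\<in>{..<n}. borel)"
      using S by (intro borel_measurable_prod measurable_compose[OF _ hm] measurable_component_singleton) auto
    show "\<bar>\<Prod>j\<in>S. h (y j)\<bar> \<le> 1" for y
      unfolding abs_prod by (intro prod_le_1) (auto simp: h1)
  qed
  also have "(\<integral>\<omega>. (if card (\<Phi> \<omega>) = n then (\<Prod>j\<in>S. h ((\<lambda>j\<in>{..<n}. Y j \<omega>) j)) else 0) \<partial>\<Omega>) =
     (\<integral>\<omega>. (if card (\<Phi> \<omega>) = n then (\<Prod>j\<in>S. h (Y j \<omega>)) else 0) \<partial>\<Omega>)"
    using S by (intro Bochner_Integration.integral_cong refl if_cong prod.cong) auto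
  finally show ?thesis .
qed

lemma card_retained:
  assumes "\<omega> \<in> space \<Omega>"
  shows "\<Psi> \<omega> = (\<lambda>j. Y j \<omega>) ` {j\<in>{..<card (\<Phi> \<omega>)}. Y j \<omega> \<in> \<Psi> \<omega>}"
    and "card (\<Psi> \<omega>) = card {j\<in>{..<card (\<Phi> \<omega>)}. Y j \<omega> \<in> \<Psi> \<omega>}"
proof -
  have b: "bij_betw (\<lambda>j. Y j \<omega>) {..<card (\<Phi> \<omega>)} (\<Phi> \<omega>)" and sub: "\<Psi> \<omega> \<subseteq> \<Phi> \<omega>"
    using en thin assms by (auto simp: enumerates_def independent_thinning_def)
  show eq: "\<Psi> \<omega> = (\<lambda>j. Y j \<omega>) ` {j\<in>{..<card (\<Phi> \<omega>)}. Y j \<omega> \<in> \<Psi> \<omega>}"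
  proof (intro equalityI subsetI)
    fix y assume y: "y \<in> \<Psi> \<omega>"
    with sub have "y \<in> (\<lambda>j. Y j \<omega>) ` {..<card (\<Phi> \<omega>)}"
      unfolding bij_betw_imp_surj_on[OF b] by (rule subsetD)
    then obtain j where "j < card (\<Phi> \<omega>)" "y = Y j \<omega>" by auto
    with y show "y \<in> (\<lambda>j. Y j \<omega>) ` {j\<in>{..<card (\<Phi> \<omega>)}. Y j \<omega> \<in> \<Psi> \<omega>}" by simp
  qed auto
  have "inj_on (\<lambda>j. Y j \<omega>) {j\<in>{..<card (\<Phi> \<omega>)}. Y j \<omega> \<in> \<Psi> \<omega>}"
    by (rule inj_on_subset[OF bij_betw_imp_inj_on[OF b]]) auto
  then show "card (\<Psi> \<omega>) = card {j\<in>{..<card (\<Phi> \<omega>)}. Y j \<omega> \<in> \<Psi> \<omega>}"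
    using arg_cong[OF eq, of card] by (simp only: card_image)
qed

text \<open>The patterns with card S = k cut the event into finitely many disjoint pieces.
  Measurability of T is needed only piecewise, where a condition on the random set turns into one on
  finitely many labels.\<close>

lemma prob_sum_patterns:
  assumes T: "\<And>S. S \<subseteq> {..<n} \<Longrightarrow> card S = k \<Longrightarrow> {\<omega>\<in>pattern n S. T \<omega>} \<in> events"
  shows "prob {\<omega>\<in>space \<Omega>. card (\<Phi> \<omega>) = n \<and> card (\<Psi> \<omega>) = k \<and> T \<omega>} =
    (\<Sum>S | S \<subseteq> {..<n} \<and> card S = k. prob {\<omega>\<in>pattern n S. T \<omega>})"
    and "{\<omega>\<in>space \<Omega>. card (\<Phi> \<omega>) = n \<and> card (\<Psi> \<omega>) = k \<and> T \<omega>} \<in> events"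
proof -
  have eq: "{\<omega>\<in>space \<Omega>. card (\<Phi> \<omega>) = n \<and> card (\<Psi> \<omega>) = k \<and> T \<omega>} =
      (\<Union>S\<in>{S. S \<subseteq> {..<n} \<and> card S = k}. {\<omega>\<in>pattern n S. T \<omega>})"
    by (auto simp: pattern_def card_retained(2))
  have fin: "finite {S. S \<subseteq> {..<n} \<and> card S = k}" by (rule finite_subset[of _ "Pow {..<n}"]) auto
  show "prob {\<omega>\<in>space \<Omega>. card (\<Phi> \<omega>) = n \<and> card (\<Psi> \<omega>) = k \<and> T \<omega>} =
    (\<Sum>S | S \<subseteq> {..<n} \<and> card S = k. prob {\<omega>\<in>pattern n S. T \<omega>})"
    unfolding eq using T fin
    by (intro finite_measure_finite_Union) (auto simp: disjoint_family_on_def pattern_def)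
  show "{\<omega>\<in>space \<Omega>. card (\<Phi> \<omega>) = n \<and> card (\<Psi> \<omega>) = k \<and> T \<omega>} \<in> events"
    unfolding eq using T fin by (intro sets.finite_UN) auto
qed

lemma prob_card_retained:
  "prob {\<omega>\<in>space \<Omega>. card (\<Phi> \<omega>) = n \<and> card (\<Psi> \<omega>) = k} =
     real (n choose k) * (p ^ k * (1 - p) ^ (n - k) * mass n)"
  "{\<omega>\<in>space \<Omega>. card (\<Phi> \<omega>) = n \<and> card (\<Psi> \<omega>) = k} \<in> events"
proof -
  have "prob {\<omega>\<in>space \<Omega>. card (\<Phi> \<omega>) = n \<and> card (\<Psi> \<omega>) = k} =
      (\<Sum>S | S \<subseteq> {..<n} \<and> card S = k. p ^ k * (1 - p) ^ (n - k) * mass n)"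
    using prob_sum_patterns(1)[of n k "\<lambda>_. True"] prob_pattern by simp
  then show "prob {\<omega>\<in>space \<Omega>. card (\<Phi> \<omega>) = n \<and> card (\<Psi> \<omega>) = k} =
     real (n choose k) * (p ^ k * (1 - p) ^ (n - k) * mass n)"
    by (simp add: n_subsets)
  show "{\<omega>\<in>space \<Omega>. card (\<Phi> \<omega>) = n \<and> card (\<Psi> \<omega>) = k} \<in> events"
    using prob_sum_patterns(2)[of n k "\<lambda>_. True"] by simp
qed

text \<open>The law of the gains depends on n only through min M n, so a single h serves all n with
  min M n = l. Each such n gives the factor \<open>c ^ k\<close> relative to its share of the
  conditioning event, and a common factor survives the countable sum over n.\<close>

lemma cond_prob_gains:
  fixes \<tau> :: "'a \<Rightarrow> real" and l k :: nat
  assumes k: "k \<ge> 1" and \<tau>m[measurable]: "\<tau> \<in> borel_measurable borel" and \<tau>: "\<And>y. \<tau> y \<ge> 0"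
  defines "h \<equiv> \<lambda>y. if y = 0 then 1 else gain_cdf l (\<tau> y)"
  assumes h1: "\<And>y. \<bar>h y\<bar> \<le> 1"
    and pos: "prob {\<omega>\<in>space \<Omega>. min M (card (\<Phi> \<omega>)) = l \<and> card (\<Psi> \<omega>) = k} > 0"
  shows "\<P>(\<omega> in \<Omega>. (\<forall>y\<in>\<Psi> \<omega>. y = 0 \<or> g \<omega> y \<le> \<tau> y) \<bar> min M (card (\<Phi> \<omega>)) = l \<and> card (\<Psi> \<omega>) = k) =
    ((LINT y:W|lborel. h y) / measure lborel W) ^ k"
proof -
  define c where "c = (LINT y:W|lborel. h y) / measure lborel W"
  define T where "T \<omega> \<longleftrightarrow> (\<forall>y\<in>\<Psi> \<omega>. y = 0 \<or> g \<omega> y \<le> \<tau> y)" for \<omega>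
  note [measurable] = measurable_gain
  have hm: "h \<in> borel_measurable borel" unfolding h_def gain_cdf_def by measurable
  have Tpat: "{\<omega>\<in>pattern n S. T \<omega>} = {\<omega>\<in>pattern n S. \<forall>j\<in>S. Y j \<omega> = 0 \<or> g \<omega> (Y j \<omega>) \<le> \<tau> (Y j \<omega>)}" for n S
  proof -
    have "T \<omega> \<longleftrightarrow> (\<forall>j\<in>S. Y j \<omega> = 0 \<or> g \<omega> (Y j \<omega>) \<le> \<tau> (Y j \<omega>))" if "\<omega> \<in> pattern n S" for \<omega>
    proof -
      have "\<Psi> \<omega> = (\<lambda>j. Y j \<omega>) ` S" using that card_retained(1)[of \<omega>] by (auto simp: pattern_def)
      then show ?thesis by (simp add: T_def)
    qed
    then show ?thesis by auto
  qed
  have Tev: "{\<omega>\<in>pattern n S. T \<omega>} \<in> events" if "S \<subseteq> {..<n}" for n S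
  proof -
    have [simp]: "finite S" using that finite_subset by auto
    have "{\<omega>\<in>pattern n S. T \<omega>} =
       pattern n S \<inter> {\<omega>\<in>space \<Omega>. \<forall>j\<in>S. Y j \<omega> = 0 \<or> g \<omega> (Y j \<omega>) \<le> \<tau> (Y j \<omega>)}"
      unfolding Tpat by (auto simp: pattern_def)
    also have "\<dots> \<in> events" by measurable
    finally show ?thesis .
  qed
  \<comment> \<open>All S of size k have the same thinning weight, which leaves the symmetric sum of
    \<open>ppp_subset_sums\<close>. There k of the n factors carry the integral of h in place of the
    measure of the window; their quotient is c.\<close>
  have ratio: "prob {\<omega>\<in>space \<Omega>. card (\<Phi> \<omega>) = n \<and> card (\<Psi> \<omega>) = k \<and> T \<omega>} =
      c ^ k * prob {\<omega>\<in>space \<Omega>. card (\<Phi> \<omega>) = n \<and> card (\<Psi> \<omega>) = k}" if l: "min M n = l" for n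
  proof -
    have "prob {\<omega>\<in>space \<Omega>. card (\<Phi> \<omega>) = n \<and> card (\<Psi> \<omega>) = k \<and> T \<omega>} =
        (\<Sum>S | S \<subseteq> {..<n} \<and> card S = k. prob {\<omega>\<in>pattern n S. T \<omega>})"
      using Tev by (intro prob_sum_patterns) auto
    also have "\<dots> = (\<Sum>S | S \<subseteq> {..<n} \<and> card S = k. p ^ k * (1 - p) ^ (n - k) *
        (\<integral>\<omega>. (if card (\<Phi> \<omega>) = n then \<Prod>j\<in>S. h (Y j \<omega>) else 0) \<partial>\<Omega>))"
    proof (intro sum.cong refl)
      fix S assume S: "S \<in> {S. S \<subseteq> {..<n} \<and> card S = k}"
      then have "S \<subseteq> {..<n}" "S \<noteq> {}" using k by auto
      from prob_pattern_gains[OF this \<tau>m \<tau>] h1 S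
      show "prob {\<omega>\<in>pattern n S. T \<omega>} = p ^ k * (1 - p) ^ (n - k) *
        (\<integral>\<omega>. (if card (\<Phi> \<omega>) = n then \<Prod>j\<in>S. h (Y j \<omega>) else 0) \<partial>\<Omega>)"
        unfolding Tpat h_def l by simp
    qed
    also have "\<dots> = p ^ k * (1 - p) ^ (n - k) * (real (n choose k) * (lam * (LINT y:W|lborel. h y)) ^ k *
        (lam * measure lborel W) ^ (n - k) / fact n * exp (- (lam * measure lborel W)))"
      unfolding sum_distrib_left[symmetric]
      using ppp_subset_sums[OF prob_space_axioms ppp en W(1,2) hm h1] by simp
    also have "\<dots> = c ^ k * (real (n choose k) * (p ^ k * (1 - p) ^ (n - k) * mass n))"
    proof (cases "k \<le> n")
      case True
      have "(lam * (LINT y:W|lborel. h y)) ^ k * (lam * measure lborel W) ^ (n - k) =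
          (c * (lam * measure lborel W)) ^ k * (lam * measure lborel W) ^ (n - k)"
        using W(3) by (simp add: c_def mult.commute)
      also have "\<dots> = c ^ k * (lam * measure lborel W) ^ n"
        using True by (simp add: power_mult_distrib[of c] power_add[symmetric])
      finally show ?thesis by (simp add: mass_def)
    qed (simp add: binomial_eq_0)
    finally show ?thesis by (simp add: prob_card_retained)
  qed
  \<comment> \<open>The condition on min M n sits inside the sets, so slices for other values of l
    are empty and the union over all n is the full event.\<close>
  define A where "A n = {\<omega>\<in>space \<Omega>. card (\<Phi> \<omega>) = n \<and> card (\<Psi> \<omega>) = k \<and> (min M n = l \<and> T \<omega>)}" for n
  define B where "B n = {\<omega>\<in>space \<Omega>. card (\<Phi> \<omega>) = n \<and> card (\<Psi> \<omega>) = k \<and> min M n = l}" for n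
  have "(\<lambda>n. prob (A n)) sums prob (\<Union>n. A n)"
  proof (rule finite_measure_UNION)
    have "A n \<in> events" for n
      using prob_sum_patterns(2)[OF Tev, of n k] by (cases "min M n = l") (simp_all add: A_def)
    then show "range A \<subseteq> events" by auto
  qed (auto simp: disjoint_family_on_def A_def)
  moreover have "prob (A n) = c ^ k * prob (B n)" for n
    using ratio[of n] by (cases "min M n = l") (simp_all add: A_def B_def)
  ultimately have "(\<lambda>n. c ^ k * prob (B n)) sums prob (\<Union>n. A n)" by simp
  moreover have "(\<lambda>n. prob (B n)) sums prob (\<Union>n. B n)"
  proof (rule finite_measure_UNION)
    have "B n \<in> events" for n
      using prob_card_retained(2)[of n k] by (cases "min M n = l") (simp_all add: B_def)
    then show "range B \<subseteq> events" by auto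
  qed (auto simp: disjoint_family_on_def B_def)
  then have "(\<lambda>n. c ^ k * prob (B n)) sums (c ^ k * prob (\<Union>n. B n))" by (rule sums_mult)
  ultimately have "prob (\<Union>n. A n) = c ^ k * prob (\<Union>n. B n)" by (rule sums_unique2)
  moreover have "(\<Union>n. A n) = {\<omega>\<in>space \<Omega>. T \<omega> \<and> (min M (card (\<Phi> \<omega>)) = l \<and> card (\<Psi> \<omega>) = k)}"
    by (auto simp: A_def)
  moreover have "(\<Union>n. B n) = {\<omega>\<in>space \<Omega>. min M (card (\<Phi> \<omega>)) = l \<and> card (\<Psi> \<omega>) = k}"
    by (auto simp: B_def)
  ultimately show ?thesis
    using pos unfolding cond_prob_def T_def[symmetric] c_def[symmetric] by simp
qed

end

section \<open>Polar coordinates and the distance density\<close>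

text \<open>The inequalities are the strict triangle inequalities for sides x, y, D. By the law of
  cosines the two arccos terms are angles of this triangle, and by Heron's formula the root is four
  times its area: the overlap is two circular sectors minus a kite. Its derivative in y is the
  length of the arc of radius y inside the disk of radius D.\<close>

lemma overlap_area_has_derivative:
  assumes D: "D > 0" and x: "0 < x" and y: "0 < y" "D - x < y" "x - D < y" "y < D + x"
  shows "(overlap_area D x has_real_derivative 2 * y * arccos ((y\<^sup>2 + x\<^sup>2 - D\<^sup>2) / (2 * x * y))) (at y)"
proof -
  define u where "u = (\<lambda>y. (D\<^sup>2 + x\<^sup>2 - y\<^sup>2) / (2 * x * D))"
  define v where "v = (\<lambda>y. (y\<^sup>2 + x\<^sup>2 - D\<^sup>2) / (2 * x * y))"
  define R where "R = (\<lambda>y. ((y + x)\<^sup>2 - D\<^sup>2) * (D\<^sup>2 - (y - x)\<^sup>2))"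
  define s where "s = sqrt (R y)"
  have "(y + x)\<^sup>2 - D\<^sup>2 = (y + x - D) * (y + x + D)" "D\<^sup>2 - (y - x)\<^sup>2 = (D - y + x) * (D + y - x)"
    by (simp_all add: power2_eq_square algebra_simps)
  then have Rpos: "R y > 0" unfolding R_def using assms by simp
  then have spos: "s > 0" by (simp add: s_def)
  have s2: "s\<^sup>2 = R y" using Rpos by (simp add: s_def)
  \<comment> \<open>The area of the triangle is s / 4, so the sines of the two angles are s / (2 x
    D) and s / (2 x y).\<close>
  have Ru: "1 - (u y)\<^sup>2 = (s / (2 * x * D))\<^sup>2"
    using assms unfolding power_divide s2 u_def R_def
    by (simp add: divide_simps) (simp add: power2_eq_square algebra_simps)
  have Rv: "1 - (v y)\<^sup>2 = (s / (2 * x * y))\<^sup>2"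
    using assms unfolding power_divide s2 v_def R_def
    by (simp add: divide_simps) (simp add: power2_eq_square algebra_simps)
  have su: "sqrt (1 - (u y)\<^sup>2) = s / (2 * x * D)" and sv: "sqrt (1 - (v y)\<^sup>2) = s / (2 * x * y)"
    unfolding Ru Rv using spos assms by simp_all
  have "(u y)\<^sup>2 < 1" "(v y)\<^sup>2 < 1"
  proof -
    have "0 < (s / (2 * x * D))\<^sup>2" "0 < (s / (2 * x * y))\<^sup>2" using spos assms by simp_all
    then show "(u y)\<^sup>2 < 1" "(v y)\<^sup>2 < 1" using Ru Rv by linarith+
  qed
  then have u1: "- 1 < u y" "u y < 1" and v1: "- 1 < v y" "v y < 1"
    by (auto simp: abs_square_less_1 abs_less_iff)
  have du: "(u has_real_derivative - y / (x * D)) (at y)"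
    unfolding u_def using assms by (auto intro!: derivative_eq_intros simp: field_simps)
  have dv: "(v has_real_derivative (y\<^sup>2 - x\<^sup>2 + D\<^sup>2) / (2 * x * y\<^sup>2)) (at y)"
    unfolding v_def using assms
    by (auto intro!: derivative_eq_intros simp: field_simps power2_eq_square)
  have dR: "(R has_real_derivative 4 * y * (D\<^sup>2 - y\<^sup>2 + x\<^sup>2)) (at y)"
    unfolding R_def
    by (auto intro!: derivative_eq_intros simp: power2_eq_square algebra_simps)
  have d1: "((\<lambda>y. arccos (u y)) has_real_derivative inverse (- (s / (2 * x * D))) * (- y / (x * D))) (at y)"
    using DERIV_chain2[OF DERIV_arccos[OF u1] du] by (simp only: su)
  have d2: "((\<lambda>y. arccos (v y)) has_real_derivative
      inverse (- (s / (2 * x * y))) * ((y\<^sup>2 - x\<^sup>2 + D\<^sup>2) / (2 * x * y\<^sup>2))) (at y)"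
    using DERIV_chain2[OF DERIV_arccos[OF v1] dv] by (simp only: sv)
  have d3: "((\<lambda>y. sqrt (R y)) has_real_derivative inverse s / 2 * (4 * y * (D\<^sup>2 - y\<^sup>2 + x\<^sup>2))) (at y)"
    using DERIV_chain2[OF DERIV_real_sqrt[OF Rpos] dR] by (simp only: s_def)
  have "((\<lambda>y. D\<^sup>2 * arccos (u y) + y\<^sup>2 * arccos (v y) - 1 / 2 * sqrt (R y)) has_real_derivative
     D\<^sup>2 * (inverse (- (s / (2 * x * D))) * (- y / (x * D))) +
     (2 * y * arccos (v y) + inverse (- (s / (2 * x * y))) * ((y\<^sup>2 - x\<^sup>2 + D\<^sup>2) / (2 * x * y\<^sup>2)) * y\<^sup>2) -
     1 / 2 * (inverse s / 2 * (4 * y * (D\<^sup>2 - y\<^sup>2 + x\<^sup>2)))) (at y)"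
  proof (intro DERIV_diff DERIV_add DERIV_cmult d1 d3)
    show "((\<lambda>y. y\<^sup>2 * arccos (v y)) has_real_derivative 2 * y * arccos (v y) +
       inverse (- (s / (2 * x * y))) * ((y\<^sup>2 - x\<^sup>2 + D\<^sup>2) / (2 * x * y\<^sup>2)) * y\<^sup>2) (at y)"
      using DERIV_mult[OF DERIV_pow[of 2 y] d2] by simp
  qed
  also have "D\<^sup>2 * (inverse (- (s / (2 * x * D))) * (- y / (x * D))) = 2 * D\<^sup>2 * y / s"
    using spos assms by (simp add: field_simps power2_eq_square)
  also have "inverse (- (s / (2 * x * y))) * ((y\<^sup>2 - x\<^sup>2 + D\<^sup>2) / (2 * x * y\<^sup>2)) * y\<^sup>2 =
      - (y * (y\<^sup>2 - x\<^sup>2 + D\<^sup>2) / s)"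
    using spos assms by (simp add: divide_simps power2_eq_square)
  \<comment> \<open>Over the common denominator s the terms without arccos add up to y times
    \<open>2 * D\<^sup>2 - (y\<^sup>2 - x\<^sup>2 + D\<^sup>2) - (D\<^sup>2 - y\<^sup>2 +
    x\<^sup>2)\<close>, which is 0.\<close>
  also have "2 * D\<^sup>2 * y / s + (2 * y * arccos (v y) + - (y * (y\<^sup>2 - x\<^sup>2 + D\<^sup>2) / s)) -
     1 / 2 * (inverse s / 2 * (4 * y * (D\<^sup>2 - y\<^sup>2 + x\<^sup>2))) = 2 * y * arccos (v y)"
    using spos by (simp add: field_simps)
  finally have *: "((\<lambda>y. D\<^sup>2 * arccos (u y) + y\<^sup>2 * arccos (v y) - 1 / 2 * sqrt (R y))
     has_real_derivative 2 * y * arccos (v y)) (at y)" .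
  show ?thesis
    using * unfolding overlap_area_def[abs_def] u_def v_def R_def .
qed

section \<open>Polar coordinates in the plane\<close>

lemma measurable_vec2: "(\<lambda>(a, b). vector [a, b] :: real^2) \<in> borel_measurable (lborel \<Otimes>\<^sub>M lborel)"
proof -
  have "(\<lambda>x. (\<lambda>(a, b). vector [a, b] :: real^2) x $ i) \<in> borel_measurable (lborel \<Otimes>\<^sub>M lborel)" for i
    using exhaust_2[of i] by (auto simp: case_prod_beta)
  then show ?thesis
    by (subst borel_measurable_euclidean_space) (auto simp: Basis_vec_def inner_axis)
qed

text \<open>Lebesgue measure is determined by the volumes of boxes. The change of variables takes
  place on \<open>real^2\<close>, iterated integration on pairs of reals; this equation joins the
  two.\<close>

lemma lborel_vec2: "(lborel :: (real^2) measure) = distr (lborel \<Otimes>\<^sub>M lborel) borel (\<lambda>(a, b). vector [a, b])"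
proof (rule lborel_eqI)
  note [measurable] = measurable_vec2
  fix l u :: "real^2" assume lu: "\<And>b. b \<in> Basis \<Longrightarrow> l \<bullet> b \<le> u \<bullet> b"
  have le: "l $ 1 \<le> u $ 1" "l $ 2 \<le> u $ 2"
    using lu[of "axis 1 1"] lu[of "axis 2 1"] by (simp_all add: inner_axis)
  have "emeasure (distr (lborel \<Otimes>\<^sub>M lborel) borel (\<lambda>(a, b). vector [a, b])) (box l u) =
      emeasure (lborel \<Otimes>\<^sub>M lborel) ({l$1<..<u$1} \<times> {l$2<..<u$2})"
    by (subst emeasure_distr) (auto simp: mem_box_cart forall_2 space_pair_measure intro!: arg_cong2[where f=emeasure])
  also have "\<dots> = ennreal (u$1 - l$1) * ennreal (u$2 - l$2)"
    using le by (simp add: lborel.emeasure_pair_measure_Times)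
  also have "\<dots> = (\<Prod>b\<in>Basis. (u - l) \<bullet> b)"
    using le by (simp add: Basis_vec_def UNIV_2 inner_axis axis_eq_axis ennreal_mult'' mult.commute)
  finally show "emeasure (distr (lborel \<Otimes>\<^sub>M lborel) borel (\<lambda>(a, b). vector [a, b])) (box l u) =
      (\<Prod>b\<in>Basis. (u - l) \<bullet> b)" .
qed simp

text \<open>The angle is counted from the direction \<beta>, later that of the centre of the disk,
  so that the centre lies on the ray of angle 0. Radius and angle form a vector so that the Jacobian
  is the determinant of a matrix.\<close>

definition polar :: "real \<Rightarrow> real^2 \<Rightarrow> real^2" where
  "polar \<beta> v = vector [v $ 1 * cos (v $ 2 + \<beta>), v $ 1 * sin (v $ 2 + \<beta>)]"

definition polar_domain :: "(real^2) set" where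
  "polar_domain = {v. 0 < v $ 1 \<and> - pi < v $ 2 \<and> v $ 2 < pi}"

lemma norm_vec2: "norm (z :: real^2) = sqrt ((z $ 1)\<^sup>2 + (z $ 2)\<^sup>2)"
  by (simp add: norm_vec_def L2_set_def UNIV_2)

lemma norm_polar: "norm (polar \<beta> v) = \<bar>v $ 1\<bar>"
  by (simp add: norm_vec2 polar_def power_mult_distrib flip: distrib_left)

lemma inj_on_polar: "inj_on (polar \<beta>) polar_domain"
proof (rule inj_onI)
  fix v w assume v: "v \<in> polar_domain" and w: "w \<in> polar_domain" and eq: "polar \<beta> v = polar \<beta> w"
  have 1: "v $ 1 = w $ 1"
    using v w arg_cong[OF eq, of norm] by (simp add: norm_polar polar_domain_def)
  have "polar \<beta> v $ 1 = polar \<beta> w $ 1" "polar \<beta> v $ 2 = polar \<beta> w $ 2" by (simp_all add: eq)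
  then have "sin (v $ 2 + \<beta>) = sin (w $ 2 + \<beta>) \<and> cos (v $ 2 + \<beta>) = cos (w $ 2 + \<beta>)"
    using v by (auto simp: polar_def 1 polar_domain_def)
  then obtain n :: int where n: "v $ 2 + \<beta> = w $ 2 + \<beta> + 2 * pi * n"
    unfolding sin_cos_eq_iff by auto
  have "\<bar>v $ 2 - w $ 2\<bar> < 2 * pi" using v w by (auto simp: polar_domain_def)
  then have "\<bar>2 * pi * n\<bar> < 2 * pi" using n by (simp add: algebra_simps)
  then have "n = 0" by (simp add: abs_mult)
  then show "v = w" using n 1 by (simp add: vec_eq_iff forall_2)
qed

text \<open>Only the closed half line opposite to the direction \<beta> is missed. It lies on the
  line through the origin with normal \<open>?a\<close>, which is a hyperplane.\<close>

lemma negligible_Compl_polar: "negligible (- polar \<beta> ` polar_domain)"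
proof (rule negligible_subset)
  let ?a = "vector [- sin \<beta>, cos \<beta>] :: real^2"
  have "sin \<beta> \<noteq> 0 \<or> cos \<beta> \<noteq> 0"
    using sin_cos_squared_add[of \<beta>] by force
  then have "?a \<noteq> 0" by (auto simp: vec_eq_iff forall_2)
  then show "negligible {z. ?a \<bullet> z = 0}" by (intro negligible_hyperplane) auto
  show "- polar \<beta> ` polar_domain \<subseteq> {z. ?a \<bullet> z = 0}"
  proof (rule subsetI, rule ccontr)
    fix z assume z: "z \<in> - polar \<beta> ` polar_domain" and "z \<notin> {z. ?a \<bullet> z = 0}"
    then have nz: "cos \<beta> * z $ 2 - sin \<beta> * z $ 1 \<noteq> 0" by (simp add: inner_vec_def sum_2)
    \<comment> \<open>The rotation by -\<beta> takes that line to the real axis, off which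
      \<open>Arg\<close> lies strictly between -pi and pi.\<close>
    define w where "w = Complex (z $ 1) (z $ 2) * cis (- \<beta>)"
    have im: "Im w \<noteq> 0" using nz by (simp add: w_def algebra_simps)
    have w0: "w \<noteq> 0" using im by auto
    have "Arg w \<noteq> pi"
    proof
      assume "Arg w = pi"
      then have "Im w = 0" using rcis_cmod_Arg[of w] Im_rcis[of "cmod w" "Arg w"] by simp
      then show False using im by simp
    qed
    then have A: "- pi < Arg w" "Arg w < pi" using Arg_bounded[of w] by auto
    have "Complex (z $ 1) (z $ 2) = w * cis \<beta>" by (simp add: w_def mult.assoc cis_mult)
    also have "\<dots> = rcis (cmod w) (Arg w + \<beta>)"
      by (subst (1) rcis_cmod_Arg[symmetric]) (simp add: rcis_def mult.assoc cis_mult)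
    finally have "Re (Complex (z $ 1) (z $ 2)) = cmod w * cos (Arg w + \<beta>)"
      "Im (Complex (z $ 1) (z $ 2)) = cmod w * sin (Arg w + \<beta>)" by (simp_all only: Re_rcis Im_rcis)
    then have "z = polar \<beta> (vector [cmod w, Arg w])"
      by (simp add: polar_def vec_eq_iff forall_2)
    moreover have "vector [cmod w, Arg w] \<in> polar_domain" using A w0 by (simp add: polar_domain_def)
    ultimately show False using z by blast
  qed
qed

lemma open_polar_domain: "open polar_domain"
  unfolding polar_domain_def by (intro open_Collect_conj open_Collect_less continuous_intros)

lemma polar_has_derivative:
  "(polar \<beta> has_derivative (\<lambda>h. vector [h $ 1 * cos (v $ 2 + \<beta>) - v $ 1 * sin (v $ 2 + \<beta>) * h $ 2,
      h $ 1 * sin (v $ 2 + \<beta>) + v $ 1 * cos (v $ 2 + \<beta>) * h $ 2])) (at v within S)"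
proof -
  have nth: "((\<lambda>v::real^2. v $ i) has_derivative (\<lambda>h. h $ i)) (at v within S)" for i
    by (rule bounded_linear.has_derivative[OF bounded_linear_vec_nth has_derivative_ident])
  have "((\<lambda>v. v $ 1 * cos (v $ 2 + \<beta>)) has_derivative
      (\<lambda>h. h $ 1 * cos (v $ 2 + \<beta>) - v $ 1 * sin (v $ 2 + \<beta>) * h $ 2)) (at v within S)"
    by (rule has_derivative_eq_rhs, (rule derivative_intros nth)+) (simp add: fun_eq_iff algebra_simps)
  moreover have "((\<lambda>v. v $ 1 * sin (v $ 2 + \<beta>)) has_derivative
      (\<lambda>h. h $ 1 * sin (v $ 2 + \<beta>) + v $ 1 * cos (v $ 2 + \<beta>) * h $ 2)) (at v within S)"
    by (rule has_derivative_eq_rhs, (rule derivative_intros nth)+) (simp add: fun_eq_iff algebra_simps)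
  ultimately show ?thesis
    unfolding polar_def[abs_def]
    by (subst has_derivative_componentwise_within) (auto simp: Basis_vec_def UNIV_2 inner_axis)
qed

text \<open>The image of the polar domain has full measure, the Jacobian is the radius, and Fubini
  splits the transformed integral.\<close>

lemma integral_polar:
  fixes f :: "real^2 \<Rightarrow> real"
  assumes f: "integrable lborel f"
  shows "(\<integral>z. f z \<partial>lborel) =
    (\<integral>r. (\<integral>\<theta>. indicator {0<..} r * indicator {- pi<..<pi} \<theta> * (r * f (polar \<beta> (vector [r, \<theta>]))) \<partial>lborel) \<partial>lborel)"
proof -
  have fm[measurable]: "f \<in> borel_measurable borel" using f by auto
  have pm[measurable]: "polar \<beta> \<in> borel_measurable borel"
    by (intro borel_measurable_continuous_onI has_derivative_continuous_on[OF polar_has_derivative])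
  have Sm[measurable]: "polar_domain \<in> sets borel" using open_polar_domain by simp
  define g' where "g' v = (\<lambda>h::real^2. vector [h $ 1 * cos (v $ 2 + \<beta>) - v $ 1 * sin (v $ 2 + \<beta>) * h $ 2,
      h $ 1 * sin (v $ 2 + \<beta>) + v $ 1 * cos (v $ 2 + \<beta>) * h $ 2] :: real^2)" for v :: "real^2"
  have det: "det (matrix (g' v)) = v $ 1" for v
  proof -
    have "det (matrix (g' v)) = v $ 1 * ((cos (v $ 2 + \<beta>))\<^sup>2 + (sin (v $ 2 + \<beta>))\<^sup>2)"
      unfolding det_2 matrix_def g'_def
      by (simp add: axis_def power2_eq_square algebra_simps del: sin_cos_squared_add3)
    then show ?thesis by simp
  qed
  \<comment> \<open>The change of variables concerns vector-valued integrands, so f is read as a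
    function into \<open>real^1\<close>. Since the equivalence holds for every b, it transports
    integrability and the value together.\<close>
  have cov: "(\<lambda>v. v $ 1 * f (polar \<beta> v)) absolutely_integrable_on polar_domain \<and>
      integral polar_domain (\<lambda>v. v $ 1 * f (polar \<beta> v)) = b \<longleftrightarrow>
    f absolutely_integrable_on (polar \<beta> ` polar_domain) \<and> integral (polar \<beta> ` polar_domain) f = b" for b
  proof -
    have "(\<lambda>v. \<bar>det (matrix (g' v))\<bar> *\<^sub>R (vec (f (polar \<beta> v)) :: real^1)) absolutely_integrable_on polar_domain \<and>
        integral polar_domain (\<lambda>v. \<bar>det (matrix (g' v))\<bar> *\<^sub>R (vec (f (polar \<beta> v)) :: real^1)) = vec b \<longleftrightarrow>
      (\<lambda>z. vec (f z) :: real^1) absolutely_integrable_on (polar \<beta> ` polar_domain) \<and>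
        integral (polar \<beta> ` polar_domain) (\<lambda>z. vec (f z) :: real^1) = vec b"
      using polar_has_derivative[of \<beta> _ polar_domain, folded g'_def] inj_on_polar Sm
      by (intro has_absolute_integral_change_of_variables) auto
    then have "(\<lambda>v. \<bar>v $ 1\<bar> * f (polar \<beta> v)) absolutely_integrable_on polar_domain \<and>
      integral polar_domain (\<lambda>v. \<bar>v $ 1\<bar> * f (polar \<beta> v)) = b \<longleftrightarrow>
      f absolutely_integrable_on (polar \<beta> ` polar_domain) \<and> integral (polar \<beta> ` polar_domain) f = b"
      by (simp add: absolutely_integrable_on_1_iff integral_on_1_eq det vec_eq_iff)
    moreover have "(\<lambda>v. \<bar>v $ 1\<bar> * f (polar \<beta> v)) absolutely_integrable_on polar_domain \<longleftrightarrow>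
        (\<lambda>v. v $ 1 * f (polar \<beta> v)) absolutely_integrable_on polar_domain"
      by (intro set_integrable_cong) (auto simp: polar_domain_def)
    moreover have "integral polar_domain (\<lambda>v. \<bar>v $ 1\<bar> * f (polar \<beta> v)) =
        integral polar_domain (\<lambda>v. v $ 1 * f (polar \<beta> v))"
      by (intro Henstock_Kurzweil_Integration.integral_cong) (auto simp: polar_domain_def)
    ultimately show ?thesis by simp
  qed
  have ai: "f absolutely_integrable_on UNIV"
    using f by (simp add: set_integrable_def integrable_completion)
  have I: "integral UNIV f = (\<integral>z. f z \<partial>lborel)"
    using f by (simp add: integral_lborel)
  have n1: "negligible {z \<in> UNIV - polar \<beta> ` polar_domain. f z \<noteq> 0}"
    by (rule negligible_subset[OF negligible_Compl_polar]) auto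
  have n2: "negligible {z \<in> polar \<beta> ` polar_domain - UNIV. f z \<noteq> 0}" by simp
  have "f absolutely_integrable_on (polar \<beta> ` polar_domain) \<and>
      integral (polar \<beta> ` polar_domain) f = (\<integral>z. f z \<partial>lborel)"
    using absolutely_integrable_spike_set_eq[OF n1 n2] integral_spike_set[OF n1 n2] ai I by simp
  then have J: "(\<lambda>v. v $ 1 * f (polar \<beta> v)) absolutely_integrable_on polar_domain"
    "integral polar_domain (\<lambda>v. v $ 1 * f (polar \<beta> v)) = (\<integral>z. f z \<partial>lborel)"
    unfolding cov[symmetric] by auto
  define F where "F v = indicator polar_domain v * (v $ 1 * f (polar \<beta> v))" for v
  have Fm[measurable]: "F \<in> borel_measurable borel"
    unfolding F_def by measurable
  have Fi: "integrable lborel F"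
    using J(1) by (simp add: set_integrable_def F_def[abs_def] integrable_completion)
  have "(\<integral>z. f z \<partial>lborel) = (LINT v:polar_domain|lebesgue. v $ 1 * f (polar \<beta> v))"
    unfolding J(2)[symmetric] by (rule set_lebesgue_integral_eq_integral(2)[OF J(1), symmetric])
  also have "\<dots> = integral\<^sup>L lebesgue F" by (simp add: set_lebesgue_integral_def F_def[abs_def])
  also have "\<dots> = integral\<^sup>L lborel F" by (rule integral_completion) simp
  also have "\<dots> = integral\<^sup>L (lborel \<Otimes>\<^sub>M lborel) (\<lambda>(a, b). F (vector [a, b]))"
    by (subst lborel_vec2, subst integral_distr[OF measurable_vec2]) (auto simp: case_prod_unfold)
  also have "\<dots> = (\<integral>r. (\<integral>\<theta>. F (vector [r, \<theta>]) \<partial>lborel) \<partial>lborel)"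
  proof -
    have "integrable (lborel \<Otimes>\<^sub>M lborel) (\<lambda>(a, b). F (vector [a, b]))"
      using Fi by (subst (asm) lborel_vec2, subst (asm) integrable_distr_eq[OF measurable_vec2])
        (auto simp: case_prod_unfold)
    from lborel_pair.integral_fst'[OF this] show ?thesis by simp
  qed
  also have "\<dots> = (\<integral>r. (\<integral>\<theta>. indicator {0<..} r * indicator {- pi<..<pi} \<theta> *
      (r * f (polar \<beta> (vector [r, \<theta>]))) \<partial>lborel) \<partial>lborel)"
    by (intro Bochner_Integration.integral_cong) (auto simp: F_def polar_domain_def indicator_def)
  finally show ?thesis .
qed

lemma measure_angles_cos_ge:
  assumes "- 1 \<le> c" "c \<le> 1"
  shows "measure lborel {\<theta>. - pi < \<theta> \<and> \<theta> < pi \<and> c \<le> cos \<theta>} = 2 * arccos c"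
proof -
  have a: "0 \<le> arccos c" "arccos c \<le> pi" using assms by (simp_all add: arccos_lbound arccos_ubound)
  have iff: "c \<le> cos \<theta> \<longleftrightarrow> \<bar>\<theta>\<bar> \<le> arccos c" if "- pi < \<theta>" "\<theta> < pi" for \<theta>
  proof -
    have "arccos (cos \<bar>\<theta>\<bar>) = \<bar>\<theta>\<bar>" using that by (intro arccos_cos) auto
    then show ?thesis
      using assms arccos_le_mono[of "cos \<theta>" c] by (simp add: abs_le_iff)
  qed
  show ?thesis
  proof (cases "arccos c = pi")
    case True
    then have "{\<theta>. - pi < \<theta> \<and> \<theta> < pi \<and> c \<le> cos \<theta>} = {- pi<..<pi}"
      using iff by auto
    with True show ?thesis by simp
  next
    case False
    then have "{\<theta>. - pi < \<theta> \<and> \<theta> < pi \<and> c \<le> cos \<theta>} = {- arccos c..arccos c}"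
      using iff a by auto
    with a show ?thesis by simp
  qed
qed

lemma integral_norm_cball:
  fixes x\<^sub>o :: "real^2" and \<phi> :: "real \<Rightarrow> real"
  assumes D: "D > 0" and xo: "norm x\<^sub>o \<le> D" and \<phi>[measurable]: "\<phi> \<in> borel_measurable borel"
    and C: "\<And>r. \<bar>\<phi> r\<bar> \<le> C"
  shows "(LINT z:cball x\<^sub>o D|lborel. \<phi> (norm z)) =
    pi * D\<^sup>2 * (LBINT y=0..D + norm x\<^sub>o. \<phi> y * distance_density D (norm x\<^sub>o) y)"
proof -
  define X where "X = norm x\<^sub>o"
  have X0: "X \<ge> 0" and XD: "X \<le> D" using xo by (auto simp: X_def)
  define \<beta> where "\<beta> = Arg (Complex (x\<^sub>o $ 1) (x\<^sub>o $ 2))"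
  have "Complex (x\<^sub>o $ 1) (x\<^sub>o $ 2) = rcis X \<beta>"
    unfolding \<beta>_def X_def norm_vec2 by (subst (1) rcis_cmod_Arg[symmetric]) (simp add: cmod_def)
  then have "Re (Complex (x\<^sub>o $ 1) (x\<^sub>o $ 2)) = X * cos \<beta>" "Im (Complex (x\<^sub>o $ 1) (x\<^sub>o $ 2)) = X * sin \<beta>"
    by (simp_all only: Re_rcis Im_rcis)
  then have xo1: "x\<^sub>o $ 1 = X * cos \<beta>" and xo2: "x\<^sub>o $ 2 = X * sin \<beta>" by simp_all
  have in_ball: "polar \<beta> (vector [r, \<theta>]) \<in> cball x\<^sub>o D \<longleftrightarrow> r\<^sup>2 - 2 * r * X * cos \<theta> + X\<^sup>2 \<le> D\<^sup>2" for r \<theta>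
  proof -
    have "cos \<theta> = cos (\<theta> + \<beta> - \<beta>)" by simp
    also have "\<dots> = cos (\<theta> + \<beta>) * cos \<beta> + sin (\<theta> + \<beta>) * sin \<beta>" by (rule cos_diff)
    finally have c: "cos \<theta> = cos (\<theta> + \<beta>) * cos \<beta> + sin (\<theta> + \<beta>) * sin \<beta>" .
    have "(norm (polar \<beta> (vector [r, \<theta>]) - x\<^sub>o))\<^sup>2 =
        (r * cos (\<theta> + \<beta>) - X * cos \<beta>)\<^sup>2 + (r * sin (\<theta> + \<beta>) - X * sin \<beta>)\<^sup>2"
      by (simp add: norm_vec2 polar_def xo1 xo2)
    also have "\<dots> = r\<^sup>2 * ((cos (\<theta> + \<beta>))\<^sup>2 + (sin (\<theta> + \<beta>))\<^sup>2) + X\<^sup>2 * ((cos \<beta>)\<^sup>2 + (sin \<beta>)\<^sup>2) -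
        2 * r * X * (cos (\<theta> + \<beta>) * cos \<beta> + sin (\<theta> + \<beta>) * sin \<beta>)"
      by (simp add: power2_eq_square algebra_simps del: sin_cos_squared_add3)
    also have "\<dots> = r\<^sup>2 - 2 * r * X * cos \<theta> + X\<^sup>2" by (simp add: c)
    finally have "(norm (polar \<beta> (vector [r, \<theta>]) - x\<^sub>o))\<^sup>2 = r\<^sup>2 - 2 * r * X * cos \<theta> + X\<^sup>2" .
    moreover have "norm (polar \<beta> (vector [r, \<theta>]) - x\<^sub>o) \<le> D \<longleftrightarrow>
        (norm (polar \<beta> (vector [r, \<theta>]) - x\<^sub>o))\<^sup>2 \<le> D\<^sup>2"
      using D abs_le_square_iff[of "norm (polar \<beta> (vector [r, \<theta>]) - x\<^sub>o)" D] by simp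
    ultimately show ?thesis by (simp add: dist_norm norm_minus_commute)
  qed
  define f where "f z = indicator (cball x\<^sub>o D) z * \<phi> (norm z)" for z
  have "(\<lambda>z. \<phi> (norm z)) \<in> borel_measurable (borel :: (real^2) measure)"
    by (rule measurable_compose[OF _ \<phi>]) simp
  then have fi: "integrable lborel f"
    using set_integrable_bounded[of "cball x\<^sub>o D" "\<lambda>z. \<phi> (norm z)" C] C
    by (simp add: set_integrable_def f_def[abs_def])
  define A where "A r = {\<theta>. - pi < \<theta> \<and> \<theta> < pi \<and> r\<^sup>2 - 2 * r * X * cos \<theta> + X\<^sup>2 \<le> D\<^sup>2}" for r
  have A: "r * measure lborel (A r) = indicator {0<..<D + X} r * (pi * D\<^sup>2 * distance_density D X r)"
    if r: "r > 0" "r \<noteq> D - X" "r \<noteq> D + X" for r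
  proof -
    consider "r < D - X" | "D - X < r" "r < D + X" | "r > D + X" using r by linarith
    then show ?thesis
    proof cases
      case 1
      have "r\<^sup>2 - 2 * r * X * cos \<theta> + X\<^sup>2 \<le> D\<^sup>2" for \<theta>
      proof -
        have "- cos \<theta> \<le> 1" using cos_ge_minus_one[of \<theta>] by linarith
        then have "2 * r * X * (- cos \<theta>) \<le> 2 * r * X * 1" using r X0 by (intro mult_left_mono) auto
        moreover have "(r + X)\<^sup>2 \<le> D\<^sup>2" using 1 r X0 by (intro power_mono) auto
        ultimately show ?thesis by (simp add: power2_sum algebra_simps)
      qed
      then have "A r = {- pi<..<pi}" by (auto simp: A_def)
      with 1 r X0 D show ?thesis by (simp add: distance_density_def)
    next
      case 2
      then have Xp: "X > 0" using X0 by (cases "X = 0") auto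
      define c where "c = (r\<^sup>2 + X\<^sup>2 - D\<^sup>2) / (2 * X * r)"
      have le: "r\<^sup>2 - 2 * r * X * cos \<theta> + X\<^sup>2 \<le> D\<^sup>2 \<longleftrightarrow> c \<le> cos \<theta>" for \<theta>
        unfolding c_def using Xp r by (simp add: pos_divide_le_eq algebra_simps)
      have "(r - X)\<^sup>2 \<le> D\<^sup>2" using 2 XD r by (intro abs_le_square_iff[THEN iffD1]) auto
      then have c1: "c \<le> 1" unfolding c_def using Xp r
        by (simp add: pos_divide_le_eq power2_diff algebra_simps)
      have "D\<^sup>2 \<le> (r + X)\<^sup>2" using 2 D by (intro power_mono) auto
      then have c2: "- 1 \<le> c" unfolding c_def using Xp r
        by (simp add: pos_le_divide_eq power2_sum algebra_simps)
      have "measure lborel (A r) = 2 * arccos c"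
        unfolding A_def le by (rule measure_angles_cos_ge[OF c2 c1])
      moreover have "deriv (overlap_area D X) r = 2 * r * arccos c"
        unfolding c_def using 2 Xp r XD D
        by (intro DERIV_imp_deriv overlap_area_has_derivative) auto
      ultimately show ?thesis using 2 r D by (simp add: distance_density_def)
    next
      case 3
      have "\<not> r\<^sup>2 - 2 * r * X * cos \<theta> + X\<^sup>2 \<le> D\<^sup>2" for \<theta>
      proof -
        have "2 * r * X * cos \<theta> \<le> 2 * r * X * 1" using r X0 by (intro mult_left_mono) auto
        moreover have "D\<^sup>2 < (r - X)\<^sup>2" using 3 D by (intro power_strict_mono) auto
        ultimately show ?thesis by (simp add: power2_diff)
      qed
      then have "A r = {}" by (auto simp: A_def)
      with 3 show ?thesis by simp
    qed
  qed
  have inner: "(\<integral>\<theta>. indicator {0<..} r * indicator {- pi<..<pi} \<theta> * (r * f (polar \<beta> (vector [r, \<theta>]))) \<partial>lborel) =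
      indicator {0<..} r * (\<phi> r * (r * measure lborel (A r)))" for r
  proof (cases "r > 0")
    case True
    have "(\<integral>\<theta>. indicator {0<..} r * indicator {- pi<..<pi} \<theta> * (r * f (polar \<beta> (vector [r, \<theta>]))) \<partial>lborel) =
        (\<integral>\<theta>. (r * \<phi> r) * indicator (A r) \<theta> \<partial>lborel)"
    proof (intro Bochner_Integration.integral_cong refl)
      fix \<theta>
      have "norm (polar \<beta> (vector [r, \<theta>])) = r" using True by (simp add: norm_polar)
      then show "indicator {0<..} r * indicator {- pi<..<pi} \<theta> * (r * f (polar \<beta> (vector [r, \<theta>]))) =
          (r * \<phi> r) * indicator (A r) \<theta>"
        using True in_ball[of r \<theta>] by (auto simp: f_def A_def indicator_def)
    qed
    also have "\<dots> = r * \<phi> r * measure lborel (A r)"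
      by (subst integral_mult_right_zero) simp
    finally show ?thesis using True by simp
  qed simp
  have "(LINT z:cball x\<^sub>o D|lborel. \<phi> (norm z)) = integral\<^sup>L lborel f"
    by (simp add: set_lebesgue_integral_def f_def[abs_def])
  also have "\<dots> = (\<integral>r. indicator {0<..} r * (\<phi> r * (r * measure lborel (A r))) \<partial>lborel)"
    unfolding integral_polar[OF fi, of \<beta>] inner ..
  also have "\<dots> = (\<integral>r. pi * D\<^sup>2 * (indicator {0<..<D + X} r *\<^sub>R (\<phi> r * distance_density D X r)) \<partial>lborel)"
  proof (rule integral_discrete_difference[of "{D - X, D + X}"])
    fix r assume "r \<notin> {D - X, D + X}"
    then have "r > 0 \<Longrightarrow> r * measure lborel (A r) =
        indicator {0<..<D + X} r * (pi * D\<^sup>2 * distance_density D X r)"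
      by (intro A) auto
    then show "indicator {0<..} r * (\<phi> r * (r * measure lborel (A r))) =
        pi * D\<^sup>2 * (indicator {0<..<D + X} r *\<^sub>R (\<phi> r * distance_density D X r))"
      by (cases "r > 0") auto
  qed auto
  also have "\<dots> = pi * D\<^sup>2 * (LBINT r:{0<..<D + X}. \<phi> r * distance_density D X r)"
    unfolding set_lebesgue_integral_def by (rule integral_mult_right_zero)
  also have "(LBINT r:{0<..<D + X}. \<phi> r * distance_density D X r) =
      (LBINT r=0..D + X. \<phi> r * distance_density D X r)"
    using interval_integral_Ioo[of 0 "D + X" "\<lambda>r. \<phi> r * distance_density D X r"] D X0
    by (simp add: zero_ereal_def)
  finally show ?thesis by (simp add: X_def)
qed

section \<open>The conditional distribution of the maximum\<close>

lemma poisson_weight_bounds: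
  fixes t :: real
  assumes "t \<ge> 0"
  shows "0 \<le> t ^ m / fact m * exp (- t)" "t ^ m / fact m * exp (- t) \<le> 1"
    and "(\<Sum>m=0..k. t ^ m / fact m * exp (- t)) \<le> 1"
proof -
  show nn: "0 \<le> t ^ m / fact m * exp (- t)" for m using assms by simp
  have le: "(\<Sum>m\<in>A. t ^ m / fact m * exp (- t)) \<le> 1" if "finite A" for A
  proof -
    have s: "(\<lambda>m. t ^ m / fact m) sums exp t"
      using exp_converges[of t] by (simp add: divide_inverse mult.commute)
    have "(\<Sum>m\<in>A. t ^ m / fact m) \<le> exp t"
      using sum_le_suminf[OF sums_summable[OF s] that] assms sums_unique[OF s] by simp
    then have "(\<Sum>m\<in>A. t ^ m / fact m) * exp (- t) \<le> exp t * exp (- t)"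
      by (intro mult_right_mono) auto
    then show ?thesis by (simp add: sum_distrib_right exp_minus)
  qed
  show "(\<Sum>m=0..k. t ^ m / fact m * exp (- t)) \<le> 1" by (rule le) simp
  show "t ^ m / fact m * exp (- t) \<le> 1" using le[of "{m}"] by simp
qed

theorem theorem2:
  fixes \<Omega> :: "'w measure"
    and lam D P \<alpha> p x :: real
    and M l k :: nat
    and x\<^sub>o :: "real^2"
    and \<Phi> \<Phi>\<^sub>i :: "'w \<Rightarrow> (real^2) set"
    and Y :: "nat \<Rightarrow> 'w \<Rightarrow> real^2"
    and g :: "'w \<Rightarrow> real^2 \<Rightarrow> real"
  assumes "prob_space \<Omega>"
    and "lam > 0" "D > 0" "P > 0" "\<alpha> > 0"
    and "M \<ge> 1"
    and "0 < p" "p \<le> 1"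
    and "norm x\<^sub>o \<le> D"
    and "homogeneous_ppp \<Omega> lam (cball x\<^sub>o D) \<Phi>"
    and "enumerates \<Omega> Y \<Phi>"
    and "independent_thinning \<Omega> p Y \<Phi> \<Phi>\<^sub>i"
    and "iid_gains \<Omega> M Y \<Phi> \<Phi>\<^sub>i g"
    and "l \<in> {1..M}" "k \<ge> 1"
    and "measure \<Omega> {\<omega>\<in>space \<Omega>. min M (card (\<Phi> \<omega>)) = l \<and> card (\<Phi>\<^sub>i \<omega>) = k} > 0"
    and "x > 0"
  shows "\<P>(\<omega> in \<Omega>. (MAX y\<in>\<Phi>\<^sub>i \<omega>. P * g \<omega> y * norm y powr (- \<alpha>)) \<le> x
            \<bar> min M (card (\<Phi> \<omega>)) = l \<and> card (\<Phi>\<^sub>i \<omega>) = k) =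
         (1 - (\<Sum>m=0..M - l. x ^ m / (P ^ m * fact m) *
            (LBINT y=0..D + norm x\<^sub>o.
               y powr (\<alpha> * real m) * exp (- (x * y powr \<alpha> / P))
                 * distance_density D (norm x\<^sub>o) y))) ^ k"
proof -
  note P = \<open>P > 0\<close> and D = \<open>D > 0\<close> and x = \<open>x > 0\<close>
  let ?W = "cball x\<^sub>o D"
  have area: "measure lborel ?W = pi * D\<^sup>2"
    using D by (simp add: content_cball unit_ball_vol_2)
  interpret marked_ppp \<Omega> lam p M ?W \<Phi> \<Phi>\<^sub>i Y g
    using assms area by (intro marked_ppp.intro marked_ppp_axioms.intro) simp_all
  define \<tau> where "\<tau> y = x * norm y powr \<alpha> / P" for y :: "real^2"
  have \<tau>0: "\<tau> y \<ge> 0" for y using x P by (simp add: \<tau>_def)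
  have \<tau>m: "\<tau> \<in> borel_measurable borel" unfolding \<tau>_def by measurable
  define \<phi> where "\<phi> m r = r powr (\<alpha> * real m) * exp (- (x * r powr \<alpha> / P))" for m r
  have \<phi>m[measurable]: "\<phi> m \<in> borel_measurable borel" for m unfolding \<phi>_def by measurable
  have \<phi>w: "x ^ m / (P ^ m * fact m) * \<phi> m r = (x * r powr \<alpha> / P) ^ m / fact m * exp (- (x * r powr \<alpha> / P))"
    if "r \<noteq> 0" for m r
  proof -
    have "r powr (\<alpha> * real m) = (r powr \<alpha>) ^ m"
      using that by (simp add: powr_def mult.commute mult.left_commute flip: exp_of_nat_mult)
    then show ?thesis by (simp add: \<phi>_def power_mult_distrib power_divide)
  qed
  have \<phi>C: "\<bar>\<phi> m r\<bar> \<le> fact m * (P / x) ^ m" for m r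
  proof (cases "r = 0")
    case False
    have "x ^ m / (P ^ m * fact m) * \<phi> m r \<le> 1"
      unfolding \<phi>w[OF False] using x P by (intro poisson_weight_bounds) simp
    then have "\<phi> m r \<le> fact m * (P / x) ^ m"
      using x P by (simp add: field_simps)
    then show ?thesis by (simp add: \<phi>_def)
  qed (use x P in \<open>simp add: \<phi>_def\<close>)
  define h where "h y = (if y = 0 then 1 else gain_cdf l (\<tau> y))" for y
  have h1: "\<bar>h y\<bar> \<le> 1" for y
    using poisson_weight_bounds(3)[OF \<tau>0[of y], of "M - l"] poisson_weight_bounds(1)[OF \<tau>0[of y]]
    by (auto simp: h_def gain_cdf_def intro!: sum_nonneg)
  define I where "I m = (LBINT y=0..D + norm x\<^sub>o. \<phi> m y * distance_density D (norm x\<^sub>o) y)" for m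
  have "(LINT y:?W|lborel. h y) =
      (LINT y|lborel. indicator ?W y - (\<Sum>m=0..M - l. x ^ m / (P ^ m * fact m) * (indicator ?W y *\<^sub>R \<phi> m (norm y))))"
    unfolding set_lebesgue_integral_def
  proof (rule integral_discrete_difference[of "{0}"])
    fix y :: "real^2" assume "y \<notin> {0}"
    then have y: "norm y \<noteq> 0" by simp
    have "h y = 1 - (\<Sum>m=0..M - l. x ^ m / (P ^ m * fact m) * \<phi> m (norm y))"
      unfolding \<phi>w[OF y] using y by (simp add: h_def gain_cdf_def \<tau>_def)
    then show "indicator ?W y *\<^sub>R h y = indicator ?W y -
        (\<Sum>m=0..M - l. x ^ m / (P ^ m * fact m) * (indicator ?W y *\<^sub>R \<phi> m (norm y)))"
      by (simp add: indicator_def)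
  qed auto
  also have "\<dots> = pi * D\<^sup>2 - (\<Sum>m=0..M - l. x ^ m / (P ^ m * fact m) * (pi * D\<^sup>2 * I m))"
  proof -
    have "(\<lambda>y. \<phi> m (norm y)) \<in> borel_measurable (borel :: (real^2) measure)" for m
      by (rule measurable_compose[OF _ \<phi>m]) simp
    then have "set_integrable lborel ?W (\<lambda>y. \<phi> m (norm y))" for m
      by (intro set_integrable_bounded[OF _ _ _ \<phi>C]) simp_all
    moreover define F where "F m y = indicator ?W y *\<^sub>R \<phi> m (norm y)" for m y
    ultimately have "integrable lborel (F m)" for m
      by (simp add: set_integrable_def F_def[abs_def])
    moreover have "integrable lborel (indicator ?W :: real^2 \<Rightarrow> real)"
      using emeasure_bounded_finite[OF bounded_cball, of x\<^sub>o D] by simp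
    moreover have "integral\<^sup>L lborel (F m) = pi * D\<^sup>2 * I m" for m
      using integral_norm_cball[OF D \<open>norm x\<^sub>o \<le> D\<close> \<phi>m \<phi>C]
      by (simp only: set_lebesgue_integral_def I_def F_def[abs_def])
    ultimately show ?thesis
      unfolding F_def[symmetric] by (simp add: area)
  qed
  also have "\<dots> = pi * D\<^sup>2 * (1 - (\<Sum>m=0..M - l. x ^ m / (P ^ m * fact m) * I m))"
    by (simp add: right_diff_distrib sum_distrib_left mult_ac)
  finally have ratio: "(LINT y:?W|lborel. h y) / measure lborel ?W =
      1 - (\<Sum>m=0..M - l. x ^ m / (P ^ m * fact m) * I m)"
    using D by (simp add: area)
  have "(MAX y\<in>\<Phi>\<^sub>i \<omega>. P * g \<omega> y * norm y powr (- \<alpha>)) \<le> x \<longleftrightarrow>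
      (\<forall>y\<in>\<Phi>\<^sub>i \<omega>. y = 0 \<or> g \<omega> y \<le> \<tau> y)" if "card (\<Phi>\<^sub>i \<omega>) = k" for \<omega>
  proof -
    have "finite (\<Phi>\<^sub>i \<omega>)" "\<Phi>\<^sub>i \<omega> \<noteq> {}" using that \<open>k \<ge> 1\<close> by (auto intro: card_ge_0_finite)
    moreover have "P * g \<omega> y * norm y powr (- \<alpha>) \<le> x \<longleftrightarrow> y = 0 \<or> g \<omega> y \<le> \<tau> y" for y
      using P x by (cases "y = 0") (simp_all add: \<tau>_def powr_minus field_simps)
    ultimately show ?thesis by simp
  qed
  then have "\<P>(\<omega> in \<Omega>. (MAX y\<in>\<Phi>\<^sub>i \<omega>. P * g \<omega> y * norm y powr (- \<alpha>)) \<le> x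
            \<bar> min M (card (\<Phi> \<omega>)) = l \<and> card (\<Phi>\<^sub>i \<omega>) = k) =
      \<P>(\<omega> in \<Omega>. (\<forall>y\<in>\<Phi>\<^sub>i \<omega>. y = 0 \<or> g \<omega> y \<le> \<tau> y)
            \<bar> min M (card (\<Phi> \<omega>)) = l \<and> card (\<Phi>\<^sub>i \<omega>) = k)"
    unfolding cond_prob_def by (intro arg_cong2[where f="(/)"] arg_cong[where f=prob]) auto
  also have "\<dots> = ((LINT y:?W|lborel. h y) / measure lborel ?W) ^ k"
    unfolding h_def[abs_def]
    by (rule cond_prob_gains[OF \<open>k \<ge> 1\<close> \<tau>m \<tau>0]) (use h1 assms in \<open>simp_all add: h_def\<close>)
  finally show ?thesis unfolding ratio I_def \<phi>_def .
qed

end
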